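(* Let $(X,d)$ be a compact metric space of diameter at most $2$ equipped with a non-atomic probability measure $\nu$, and let $\rho\colon\Gamma\curvearrowright(X,d,\nu)$ be a continuous measure-class-preserving and asymptotically expanding action of a countable discrete group $\Gamma$. Then the warped cone $\mathcal{O}_\Gamma X$ does not admit a coarse embedding into any Hilbert space.
   Context: Measures on metric spaces are Borel; non-atomic: every singleton has measure zero. $\Gamma$ is equipped with a fixed proper length function $\ell\colon\Gamma\to\{0,1,2,\dots\}$: $\ell(\gamma)=0$ iff $\gamma=1$, $\ell(\gamma)=\ell(\gamma^{-1})$, $\ell(\gamma_1\gamma_2)\le\ell(\gamma_1)+\ell(\gamma_2)$, and all balls $B_k:=\{\gamma:\ell(\gamma)\le k\}$ are finite. Measure-class-preserving means null sets are sent to null sets. The action is asymptotically expanding (in measure) if for every $\alpha\in(0,\frac12]$ there are $c(\alpha)>0$ and $k(\alpha)\in\mathbb{N}$ with $\nu(B_{k(\alpha)}\cdot A)>(1+c(\alpha))\nu(A)$ for every measurable $A\subseteq X$ with $\alpha\le\nu(A)\le\frac12$, where $B_k\cdot A:=\bigcup_{\gamma\in B_k}\gamma\cdot A$. For $t\ge1$ let $d^t_\Gamma$ be the largest metric on $X$ with $d^t_\Gamma\le t\,d$ and $d^t_\Gamma(x,\gamma\cdot x)\le\ell(\gamma)$ for all $x\in X,\gamma\in\Gamma$. The (unified) warped cone $\mathcal{O}_\Gamma X$ is the set $X\times[1,\infty)$ with metric $d_\Gamma((x_1,t_1),(x_2,t_2)):=d_\Gamma^{\min\{t_1,t_2\}}(x_1,x_2)+|t_1-t_2|$.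 A map $F\colon(X_1,d_1)\to(X_2,d_2)$ of metric spaces is a coarse embedding if there are non-decreasing unbounded functions $\rho_\pm\colon[0,\infty)\to[0,\infty)$ with $\rho_-(d_1(x,x'))\le d_2(F(x),F(x'))\le\rho_+(d_1(x,x'))$ for all $x,x'\in X_1$. *)

theory Defs
  imports "HOL-Probability.Probability" "HOL-Algebra.Group_Action"
begin

definition proper_length_function :: "('g, 'm) monoid_scheme \<Rightarrow> ('g \<Rightarrow> nat) \<Rightarrow> bool" where
  "proper_length_function G len \<longleftrightarrow>
     (\<forall>g\<in>carrier G. len g = 0 \<longleftrightarrow> g = \<one>\<^bsub>G\<^esub>) \<and>
     (\<forall>g\<in>carrier G. len (inv\<^bsub>G\<^esub> g) = len g) \<and>
     (\<forall>g\<in>carrier G. \<forall>h\<in>carrier G. len (g \<otimes>\<^bsub>G\<^esub> h) \<le> len g + len h) \<and>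
     (\<forall>k. finite {g \<in> carrier G. len g \<le> k})"

definition length_ball :: "('g, 'm) monoid_scheme \<Rightarrow> ('g \<Rightarrow> nat) \<Rightarrow> nat \<Rightarrow> 'g set" where
  "length_ball G len k = {g \<in> carrier G. len g \<le> k}"

definition measure_class_preserving ::
    "('g, 'm) monoid_scheme \<Rightarrow> ('g \<Rightarrow> 'a \<Rightarrow> 'a) \<Rightarrow> 'a measure \<Rightarrow> bool" where
  "measure_class_preserving G act \<nu> \<longleftrightarrow>
     (\<forall>g\<in>carrier G. \<forall>N\<in>null_sets \<nu>. act g ` N \<in> null_sets \<nu>)"

definition asymptotically_expanding ::
    "('g, 'm) monoid_scheme \<Rightarrow> ('g \<Rightarrow> nat) \<Rightarrow> ('g \<Rightarrow> 'a \<Rightarrow> 'a) \<Rightarrow> 'a measure \<Rightarrow> bool" where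
  "asymptotically_expanding G len act \<nu> \<longleftrightarrow>
     (\<forall>\<alpha>::real. 0 < \<alpha> \<and> \<alpha> \<le> 1/2 \<longrightarrow>
       (\<exists>(c::real) > 0. \<exists>k::nat. \<forall>A\<in>sets \<nu>. \<alpha> \<le> measure \<nu> A \<and> measure \<nu> A \<le> 1/2 \<longrightarrow>
         measure \<nu> (\<Union>g\<in>length_ball G len k. act g ` A) > (1 + c) * measure \<nu> A))"

definition warp_admissible ::
    "('g, 'm) monoid_scheme \<Rightarrow> ('g \<Rightarrow> nat) \<Rightarrow> ('g \<Rightarrow> 'a \<Rightarrow> 'a) \<Rightarrow> real
      \<Rightarrow> ('a::metric_space \<Rightarrow> 'a \<Rightarrow> real) \<Rightarrow> bool" where
  "warp_admissible G len act t \<delta> \<longleftrightarrow>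
     Metric_space UNIV \<delta> \<and>
     (\<forall>x y. \<delta> x y \<le> t * dist x y) \<and>
     (\<forall>x. \<forall>g\<in>carrier G. \<delta> x (act g x) \<le> real (len g))"

text \<open>The order on distance functions is the pointwise one. The greatest admissible metric
  exists when the diameter is at most 2 and \<open>t \<ge> 1\<close>; see \<open>warped_dist_greatest\<close> below.\<close>

definition warped_dist ::
    "('g, 'm) monoid_scheme \<Rightarrow> ('g \<Rightarrow> nat) \<Rightarrow> ('g \<Rightarrow> 'a \<Rightarrow> 'a) \<Rightarrow> real
      \<Rightarrow> 'a::metric_space \<Rightarrow> 'a \<Rightarrow> real" where
  "warped_dist G len act t = (GREATEST \<delta>. warp_admissible G len act t \<delta>)"

definition warped_cone :: "('a \<times> real) set" where
  "warped_cone = UNIV \<times> {1..}"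

definition warped_cone_dist ::
    "('g, 'm) monoid_scheme \<Rightarrow> ('g \<Rightarrow> nat) \<Rightarrow> ('g \<Rightarrow> 'a \<Rightarrow> 'a)
      \<Rightarrow> 'a::metric_space \<times> real \<Rightarrow> 'a \<times> real \<Rightarrow> real" where
  "warped_cone_dist G len act p q =
     warped_dist G len act (min (snd p) (snd q)) (fst p) (fst q) + \<bar>snd p - snd q\<bar>"

text \<open>Control functions \<open>[0,\<infinity>) \<rightarrow> [0,\<infinity>)\<close> are total functions on the reals, constrained
  only on \<open>{0..}\<close>.\<close>

definition control_function :: "(real \<Rightarrow> real) \<Rightarrow> bool" where
  "control_function r \<longleftrightarrow>
     r \<in> {0..} \<rightarrow> {0..} \<and> mono_on {0..} r \<and> \<not> bdd_above (r ` {0..})"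

definition coarse_embedding ::
    "'a set \<Rightarrow> ('a \<Rightarrow> 'a \<Rightarrow> real) \<Rightarrow> 'b set \<Rightarrow> ('b \<Rightarrow> 'b \<Rightarrow> real) \<Rightarrow> ('a \<Rightarrow> 'b) \<Rightarrow> bool" where
  "coarse_embedding X1 d1 X2 d2 F \<longleftrightarrow>
     F \<in> X1 \<rightarrow> X2 \<and>
     (\<exists>rm rp. control_function rm \<and> control_function rp \<and>
       (\<forall>x\<in>X1. \<forall>x'\<in>X1. rm (d1 x x') \<le> d2 (F x) (F x') \<and> d2 (F x) (F x') \<le> rp (d1 x x')))"

lemma warp_admissible_half_dist:
  fixes act :: "'g \<Rightarrow> 'a::metric_space \<Rightarrow> 'a"
  assumes act: "group_action G UNIV act" and len: "proper_length_function G len"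
    and bdd: "bounded (UNIV::'a set)" and diam: "diameter (UNIV::'a set) \<le> 2" and t: "1 \<le> t"
  shows "warp_admissible G len act t (\<lambda>x y. dist x y / 2)"
proof -
  interpret group_action G UNIV act by fact
  have le2: "dist x y \<le> 2" for x y :: 'a
    using diameter_bounded_bound[OF bdd, of x y] diam by simp
  have "Metric_space UNIV (\<lambda>x y::'a. dist x y / 2)"
  proof
    fix x y z :: 'a
    show "dist x z / 2 \<le> dist x y / 2 + dist y z / 2"
      using dist_triangle[of x z y] by linarith
  qed (auto simp: dist_commute)
  moreover have "dist x y / 2 \<le> t * dist x y" for x y :: 'a
    using mult_right_mono[OF t, of "dist x y"] zero_le_dist[of x y] by linarith
  moreover have "dist x (act g x) / 2 \<le> real (len g)" if g: "g \<in> carrier G" for x g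
  proof (cases "g = \<one>\<^bsub>G\<^esub>")
    case True
    have "act \<one>\<^bsub>G\<^esub> x = x" using id_eq_one by (metis UNIV_I restrict_apply)
    then show ?thesis using True by simp
  next
    case False
    then have "1 \<le> real (len g)"
      using len g unfolding proper_length_function_def by (metis One_nat_def Suc_leI not_gr_zero of_nat_1 of_nat_le_iff)
    then show ?thesis using le2[of x "act g x"] by linarith
  qed
  ultimately show ?thesis by (simp add: warp_admissible_def)
qed

lemma warped_dist_greatest:
  fixes act :: "'g \<Rightarrow> 'a::metric_space \<Rightarrow> 'a"
  assumes act: "group_action G UNIV act" and len: "proper_length_function G len"
    and bdd: "bounded (UNIV::'a set)" and diam: "diameter (UNIV::'a set) \<le> 2" and t: "1 \<le> t"
  shows "warp_admissible G len act t (warped_dist G len act t)"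
    and "warp_admissible G len act t \<delta> \<Longrightarrow> \<delta> \<le> warped_dist G len act t"
proof -
  define S where "S = {\<delta>. warp_admissible G len act t \<delta>}"
  define s where "s = (\<lambda>x y. SUP \<delta>\<in>S. \<delta> x y)"
  have half: "(\<lambda>x y. dist x y / 2) \<in> S"
    using warp_admissible_half_dist[OF assms] by (simp add: S_def)
  then have ne: "S \<noteq> {}" by auto
  have bd: "bdd_above ((\<lambda>\<delta>. \<delta> x y) ` S)" for x y
    by (rule bdd_aboveI[of _ "t * dist x y"]) (auto simp: S_def warp_admissible_def)
  have upper: "\<delta> x y \<le> s x y" if "\<delta> \<in> S" for \<delta> x y
    unfolding s_def using that bd by (rule cSUP_upper)
  have least: "s x y \<le> c" if "\<And>\<delta>. \<delta> \<in> S \<Longrightarrow> \<delta> x y \<le> c" for x y c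
    unfolding s_def using ne that by (rule cSUP_least)
  have met: "Metric_space UNIV \<delta>" if "\<delta> \<in> S" for \<delta>
    using that by (simp add: S_def warp_admissible_def)
  have "Metric_space UNIV s"
  proof
    show "0 \<le> s x y" for x y
      using upper[OF half, of x y] zero_le_dist[of x y] by linarith
    show "s x y = s y x" for x y
      unfolding s_def by (rule SUP_cong) (auto intro: Metric_space.commute[OF met])
    show "s x y = 0 \<longleftrightarrow> x = y" for x y
    proof
      assume "s x y = 0"
      then show "x = y" using upper[OF half, of x y] by simp
    next
      assume "x = y"
      then have "s x y \<le> 0"
        by (auto intro!: least simp: Metric_space.mdist_zero[OF met])
      then show "s x y = 0" using upper[OF half, of x y] zero_le_dist[of x y] by linarith
    qed
    show "s x z \<le> s x y + s y z" for x y z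
    proof (rule least)
      fix \<delta> assume d: "\<delta> \<in> S"
      have "\<delta> x z \<le> \<delta> x y + \<delta> y z"
        using Metric_space.triangle[OF met[OF d]] by simp
      then show "\<delta> x z \<le> s x y + s y z"
        using upper[OF d, of x y] upper[OF d, of y z] by linarith
    qed
  qed
  moreover have "s x y \<le> t * dist x y" for x y
    by (rule least) (simp add: S_def warp_admissible_def)
  moreover have "s x (act g x) \<le> real (len g)" if "g \<in> carrier G" for x g
    using that by (intro least) (simp add: S_def warp_admissible_def)
  ultimately have adm: "warp_admissible G len act t s"
    by (simp add: warp_admissible_def)
  have greatest: "\<delta> \<le> s" if "warp_admissible G len act t \<delta>" for \<delta>
    using upper[of \<delta>] that by (simp add: le_fun_def S_def)
  have "warped_dist G len act t = s"
    unfolding warped_dist_def using adm greatest by (rule Greatest_equality)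
  then show "warp_admissible G len act t (warped_dist G len act t)"
    and "warp_admissible G len act t \<delta> \<Longrightarrow> \<delta> \<le> warped_dist G len act t"
    using adm greatest by auto
qed

end

theory Submission
  imports Defs
begin

text \<open>
  A coarse embedding \<open>F\<close> restricted to the slices \<open>X \<times> {t}\<close> gives maps \<open>f\<^sub>t\<close> into a Hilbert space
  whose displacement \<open>dist (f\<^sub>t (\<gamma> x)) (f\<^sub>t x)\<close> is bounded by a constant depending on the length of
  \<open>\<gamma>\<close> only, not on \<open>t\<close>. The contradiction comes from two opposite facts about such slices.

  Concentration: there is \<open>R\<close>, independent of \<open>t\<close>, such that \<open>f\<^sub>t\<close> maps a set \<open>Y\<^sub>t\<close> of measure at least
  1/2 to a set of diameter at most \<open>R\<close> (\<open>Hilbert_concentration\<close>). For a real function \<open>\<phi>\<close> with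
  \<open>\<bar>\<phi> (\<gamma> x) - \<phi> x\<bar> \<le> K\<close> for \<open>\<gamma> \<in> B\<^sub>k\<close> outside a small set of points \<open>x\<close>, the superlevel sets
  \<open>A\<^sub>i = {\<phi> > m + i K}\<close> satisfy \<open>B\<^sub>k A\<^sub>i\<^sub>+\<^sub>1 \<subseteq> A\<^sub>i\<close> up to a small set. If \<open>m\<close> is a median, expansion
  therefore forces the measure of \<open>A\<^sub>i\<close> to drop by a fixed amount at each step until it is below \<open>\<alpha>\<close>.
  A Hilbert space valued \<open>f\<close> is reduced to this case by composing it with random functionals
  \<open>Z u = (\<Sum>e. \<plusminus> (e \<bullet> u))\<close> with independent signs along an orthonormal basis. Chebyshev's inequality
  shows that with high probability \<open>Z \<circ> f\<close> has bounded displacement at most points, and the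
  Paley-Zygmund inequality shows that two points at distance \<open>r\<close> are sent more than \<open>r / 2\<close> apart
  with probability at least 3/16. So if \<open>Z \<circ> f\<close> concentrates for most \<open>Z\<close>, then so does \<open>f\<close>.

  Dispersion: the lower control function turns the diameter bound for \<open>f\<^sub>t(Y\<^sub>t)\<close> into a bound
  \<open>d\<^sup>t \<le> S\<close> on \<open>Y\<^sub>t\<close>, uniform in \<open>t\<close>. However, \<open>d\<^sup>t(x, y)\<close> increases to infinity with \<open>t\<close> unless
  \<open>x\<close> and \<open>y\<close> lie on the same orbit (\<open>warped_dist_unbounded\<close>). If points \<open>x\<^sub>t \<in> Y\<^sub>t\<close> accumulate
  at \<open>x\<close>, then for every \<open>s\<close> the set of \<open>y\<close> with \<open>d\<^sup>s(x, y) \<le> S + 1\<close> contains some \<open>Y\<^sub>t\<close>, so it has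
  measure at least 1/2. These sets decrease as \<open>s\<close> grows, and their intersection is contained in the orbit
  of \<open>x\<close>, which is countable and hence null.
\<close>

section \<open>Random sign functionals on a real inner product space\<close>

text \<open>Gram-Schmidt, for an inner product space of arbitrary dimension. The conclusion records expansions
  instead of membership in the span: they are linear in the point, so they pass at once to
  differences of points of \<open>P\<close>.\<close>

lemma finite_orthonormal_expansion:
  fixes P :: "'h::real_inner set"
  assumes "finite P"
  shows "\<exists>E. finite E \<and> (\<forall>e\<in>E. \<forall>e'\<in>E. e \<bullet> e' = (if e = e' then 1 else 0)) \<and>
    (\<forall>p\<in>P. p = (\<Sum>e\<in>E. (e \<bullet> p) *\<^sub>R e))"
  using assms
proof induction
  case empty
  show ?case by (rule exI[of _ "{}"]) simp
next
  case (insert p P)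
  then obtain E where fin: "finite E"
    and orth: "\<And>e e'. e \<in> E \<Longrightarrow> e' \<in> E \<Longrightarrow> e \<bullet> e' = (if e = e' then 1 else 0)"
    and expand: "\<And>q. q \<in> P \<Longrightarrow> q = (\<Sum>e\<in>E. (e \<bullet> q) *\<^sub>R e)" by blast
  define r where "r = p - (\<Sum>e\<in>E. (e \<bullet> p) *\<^sub>R e)"
  have perp: "e \<bullet> r = 0" if "e \<in> E" for e
  proof -
    have "(\<Sum>e'\<in>E. (e' \<bullet> p) * (e \<bullet> e')) = (\<Sum>e'\<in>E. if e = e' then e \<bullet> p else 0)"
      using that by (intro sum.cong) (auto simp: orth)
    then show ?thesis using that fin by (simp add: r_def inner_diff_right inner_sum_right)
  qed
  show ?case
  proof (cases "r = 0")
    case True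
    then have "p = (\<Sum>e\<in>E. (e \<bullet> p) *\<^sub>R e)" by (simp add: r_def)
    then show ?thesis using fin orth expand by blast
  next
    case False
    define e0 where "e0 = r /\<^sub>R norm r"
    have e0r: "r = norm r *\<^sub>R e0" using False by (simp add: e0_def)
    have e0e0: "e0 \<bullet> e0 = 1"
      using False by (simp add: e0_def dot_square_norm power2_eq_square)
    have e0E: "e \<bullet> e0 = 0" "e0 \<bullet> e = 0" if "e \<in> E" for e
      using perp[OF that] by (simp_all add: e0_def inner_commute)
    have notin: "e0 \<notin> E" using e0E e0e0 by fastforce
    have sum_perp: "e0 \<bullet> (\<Sum>e\<in>E. c e *\<^sub>R e) = 0" for c
      by (simp add: inner_sum_right e0E)
    have "e0 \<bullet> q = 0" if "q \<in> P" for q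
      using sum_perp[of "\<lambda>e. e \<bullet> q"] expand[OF that] by simp
    moreover have "e0 \<bullet> p = norm r"
    proof -
      have "p = r + (\<Sum>e\<in>E. (e \<bullet> p) *\<^sub>R e)" by (simp add: r_def)
      then have "e0 \<bullet> p = e0 \<bullet> r"
        using sum_perp[of "\<lambda>e. e \<bullet> p"] by (metis inner_add_right add.right_neutral)
      also have "\<dots> = norm r"
        using e0e0 by (subst e0r) simp
      finally show ?thesis .
    qed
    ultimately have "q = (\<Sum>e\<in>insert e0 E. (e \<bullet> q) *\<^sub>R e)" if "q \<in> insert p P" for q
      using that fin notin expand e0r by (auto simp: r_def algebra_simps)
    moreover have "e \<bullet> e' = (if e = e' then 1 else 0)" if "e \<in> insert e0 E" "e' \<in> insert e0 E" for e e'
      using that orth e0E e0e0 notin by auto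
    ultimately show ?thesis using fin by (intro exI[of _ "insert e0 E"]) blast
  qed
qed

text \<open>The set \<open>S\<close> encodes a choice of signs. Letting it range over \<open>Pow E\<close> with counting measure models
  independent fair signs, so that expectations are finite sums.\<close>

definition signed_sum :: "'b set \<Rightarrow> ('b \<Rightarrow> real) \<Rightarrow> 'b set \<Rightarrow> real" where
  "signed_sum E a S = (\<Sum>e\<in>E. (if e \<in> S then 1 else -1) * a e)"

text \<open>The sign of a new index is independent of the others; this is the induction step for all moments.\<close>

lemma sum_signed_sum_insert:
  assumes "finite E" "x \<notin> E"
  shows "(\<Sum>S\<in>Pow (insert x E). h (signed_sum (insert x E) a S)) =
    (\<Sum>S\<in>Pow E. h (signed_sum E a S - a x) + h (signed_sum E a S + a x))"
proof -
  have 1: "signed_sum (insert x E) a S = signed_sum E a S - a x" if "S \<subseteq> E" for S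
    using assms that by (auto simp: signed_sum_def)
  have 2: "signed_sum (insert x E) a (insert x S) = signed_sum E a S + a x" if "S \<subseteq> E" for S
    using assms that by (auto simp: signed_sum_def intro!: sum.cong)
  have inj: "inj_on (insert x) (Pow E)" using assms(2) by (auto simp: inj_on_def)
  have "(\<Sum>S\<in>Pow (insert x E). h (signed_sum (insert x E) a S)) =
     (\<Sum>S\<in>Pow E. h (signed_sum (insert x E) a S)) +
     (\<Sum>S\<in>insert x ` Pow E. h (signed_sum (insert x E) a S))"
    unfolding Pow_insert using assms by (intro sum.union_disjoint) auto
  also have "\<dots> = (\<Sum>S\<in>Pow E. h (signed_sum E a S - a x)) + (\<Sum>S\<in>Pow E. h (signed_sum E a S + a x))"
    unfolding sum.reindex[OF inj] using 1 2 by (intro arg_cong2[where f = "(+)"] sum.cong) auto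
  finally show ?thesis by (simp add: sum.distrib)
qed

lemma signed_sum_second_moment:
  assumes "finite E"
  shows "(\<Sum>S\<in>Pow E. (signed_sum E a S)\<^sup>2) = 2 ^ card E * (\<Sum>e\<in>E. (a e)\<^sup>2)"
  using assms
proof induction
  case empty then show ?case by (simp add: signed_sum_def)
next
  case (insert x E)
  have "(\<Sum>S\<in>Pow (insert x E). (signed_sum (insert x E) a S)\<^sup>2) =
    (\<Sum>S\<in>Pow E. 2 * (signed_sum E a S)\<^sup>2 + 2 * (a x)\<^sup>2)"
    unfolding sum_signed_sum_insert[OF insert.hyps, of "\<lambda>z. z\<^sup>2"]
    by (intro sum.cong) (auto simp: power2_eq_square algebra_simps)
  then show ?case using insert
    by (simp add: sum.distrib card_Pow algebra_simps flip: sum_distrib_left)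
qed

text \<open>Expanding \<open>(z - a)^4 + (z + a)^4\<close> leaves the cross term \<open>12 a\<^sup>2 z\<^sup>2\<close>, whose sum is known from the second
  moment; the resulting bound is a complete square once \<open>a^4\<close> is given the coefficient 3, the fourth
  moment of a Gaussian.\<close>

lemma signed_sum_fourth_moment:
  assumes "finite E"
  shows "(\<Sum>S\<in>Pow E. (signed_sum E a S)^4) \<le> 3 * 2 ^ card E * (\<Sum>e\<in>E. (a e)\<^sup>2)\<^sup>2"
  using assms
proof induction
  case empty then show ?case by (simp add: signed_sum_def)
next
  case (insert x E)
  define s where "s = (\<Sum>e\<in>E. (a e)\<^sup>2)"
  have "(\<Sum>S\<in>Pow (insert x E). (signed_sum (insert x E) a S)^4) =
    (\<Sum>S\<in>Pow E. 2 * (signed_sum E a S)^4 + 12 * (a x)\<^sup>2 * (signed_sum E a S)\<^sup>2 + 2 * (a x)^4)"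
    unfolding sum_signed_sum_insert[OF insert.hyps, of "\<lambda>z. z^4"]
    by (intro sum.cong) (auto simp: power2_eq_square power4_eq_xxxx algebra_simps)
  also have "\<dots> = 2 * (\<Sum>S\<in>Pow E. (signed_sum E a S)^4) + 12 * (a x)\<^sup>2 * (2 ^ card E * s)
      + 2 ^ card E * 2 * (a x)^4"
    using insert.hyps signed_sum_second_moment[of E a]
    by (simp add: sum.distrib card_Pow s_def flip: sum_distrib_left)
  also have "\<dots> \<le> 2 * (3 * 2 ^ card E * s\<^sup>2) + 12 * (a x)\<^sup>2 * (2 ^ card E * s)
      + 2 ^ card E * 2 * (a x)^4 + 2 ^ card E * 4 * (a x)^4"
  proof -
    have "0 \<le> 2 ^ card E * 4 * (a x)^4" by simp
    then show ?thesis using insert.IH unfolding s_def by linarith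
  qed
  also have "\<dots> = 3 * 2 ^ card (insert x E) * (s + (a x)\<^sup>2)\<^sup>2"
    using insert.hyps by (simp add: power2_eq_square power4_eq_xxxx algebra_simps)
  finally show ?case using insert.hyps by (simp add: s_def add.commute)
qed

lemma finite_Chebyshev:
  fixes Z :: "'w \<Rightarrow> real"
  assumes "finite \<Omega>" "0 < K"
  shows "real (card {w\<in>\<Omega>. K < \<bar>Z w\<bar>}) * K\<^sup>2 \<le> (\<Sum>w\<in>\<Omega>. (Z w)\<^sup>2)"
proof -
  have "real (card {w\<in>\<Omega>. K < \<bar>Z w\<bar>}) * K\<^sup>2 = (\<Sum>w\<in>{w\<in>\<Omega>. K < \<bar>Z w\<bar>}. K\<^sup>2)" by simp
  also have "\<dots> \<le> (\<Sum>w\<in>{w\<in>\<Omega>. K < \<bar>Z w\<bar>}. (Z w)\<^sup>2)"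
  proof (rule sum_mono)
    fix w assume "w \<in> {w\<in>\<Omega>. K < \<bar>Z w\<bar>}"
    then have "K\<^sup>2 \<le> \<bar>Z w\<bar>\<^sup>2" using assms(2) by (intro power_mono) auto
    then show "K\<^sup>2 \<le> (Z w)\<^sup>2" by simp
  qed
  also have "\<dots> \<le> (\<Sum>w\<in>\<Omega>. (Z w)\<^sup>2)" using assms by (intro sum_mono2) auto
  finally show ?thesis .
qed

text \<open>Values with \<open>\<bar>Z\<bar> \<le> r / 2\<close> carry at most a quarter of the second moment. The rest sits on the set in
  question, and by Cauchy-Schwarz and the fourth moment bound this set cannot be small:
  \<open>(3/4)\<^sup>2 / 3 = 3/16\<close>.\<close>

lemma finite_Paley_Zygmund:
  fixes Z :: "'w \<Rightarrow> real"
  assumes fin: "finite \<Omega>" and r: "0 < r"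
    and second: "(\<Sum>w\<in>\<Omega>. (Z w)\<^sup>2) = real (card \<Omega>) * r\<^sup>2"
    and fourth: "(\<Sum>w\<in>\<Omega>. (Z w)^4) \<le> 3 * real (card \<Omega>) * (r\<^sup>2)\<^sup>2"
  shows "3 / 16 * real (card \<Omega>) \<le> real (card {w\<in>\<Omega>. r / 2 < \<bar>Z w\<bar>})"
proof (cases "\<Omega> = {}")
  case False
  define n where "n = real (card \<Omega>)"
  have n: "0 < n" using fin False by (simp add: n_def card_gt_0_iff)
  define B where "B = {w\<in>\<Omega>. r / 2 < \<bar>Z w\<bar>}"
  have BO: "B \<subseteq> \<Omega>" "finite B" using fin by (auto simp: B_def)
  have small: "(Z w)\<^sup>2 \<le> r\<^sup>2 / 4" if "w \<in> \<Omega> - B" for w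
  proof -
    have "\<bar>Z w\<bar>\<^sup>2 \<le> (r/2)\<^sup>2" using that by (intro power_mono) (auto simp: B_def)
    then show ?thesis by (simp add: power_divide)
  qed
  have "n * r\<^sup>2 = (\<Sum>w\<in>\<Omega> - B. (Z w)\<^sup>2) + (\<Sum>w\<in>B. (Z w)\<^sup>2)"
    using second unfolding n_def sum.subset_diff[OF BO(1) fin, of "\<lambda>w. (Z w)\<^sup>2"] by simp
  moreover have "(\<Sum>w\<in>\<Omega> - B. (Z w)\<^sup>2) \<le> n * (r\<^sup>2 / 4)"
  proof -
    have "(\<Sum>w\<in>\<Omega> - B. (Z w)\<^sup>2) \<le> real (card (\<Omega> - B)) * (r\<^sup>2/4)"
      using small by (rule sum_bounded_above)
    also have "\<dots> \<le> n * (r\<^sup>2/4)"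
      unfolding n_def using fin by (intro mult_right_mono) (auto intro: card_mono)
    finally show ?thesis .
  qed
  ultimately have large: "3/4 * n * r\<^sup>2 \<le> (\<Sum>w\<in>B. (Z w)\<^sup>2)" by simp
  have "(3/4 * n * r\<^sup>2)\<^sup>2 \<le> (\<Sum>w\<in>B. (Z w)\<^sup>2)\<^sup>2"
    using large n by (intro power_mono) auto
  also have "\<dots> = (\<Sum>w\<in>B. 1 * (Z w)\<^sup>2)\<^sup>2" by simp
  also have "\<dots> \<le> (\<Sum>w\<in>B. 1\<^sup>2) * (\<Sum>w\<in>B. ((Z w)\<^sup>2)\<^sup>2)" by (rule Cauchy_Schwarz_ineq_sum)
  also have "\<dots> = real (card B) * (\<Sum>w\<in>B. (Z w)^4)" by simp
  also have "\<dots> \<le> real (card B) * (3 * n * (r\<^sup>2)\<^sup>2)"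
  proof -
    have "(\<Sum>w\<in>B. (Z w)^4) \<le> (\<Sum>w\<in>\<Omega>. (Z w)^4)"
      using BO fin by (intro sum_mono2) auto
    then show ?thesis using fourth by (intro mult_left_mono) (auto simp: n_def)
  qed
  finally have "(9/16 * n) * (n * (r\<^sup>2)\<^sup>2) \<le> (3 * real (card B)) * (n * (r\<^sup>2)\<^sup>2)"
    by (simp add: power2_eq_square algebra_simps)
  then have "9/16 * n \<le> 3 * real (card B)"
    using n r by (subst (asm) mult_le_cancel_right_pos) auto
  then show ?thesis by (simp add: n_def B_def)
qed simp

text \<open>The random functionals through which a Hilbert space valued map is turned into real functions:
  they do not stretch distances much on average, and they shrink each given distance by more than
  the factor 2 only with probability at most 13/16. Both constants are independent of the
  dimension of the span of \<open>P\<close>.\<close>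

lemma finite_random_functionals:
  fixes P :: "'h::real_inner set"
  assumes "finite P"
  obtains \<Omega> :: "'h set set" and Z where "finite \<Omega>" and "\<Omega> \<noteq> {}"
    and "\<And>p q s. p \<in> P \<Longrightarrow> q \<in> P \<Longrightarrow> 0 < s \<Longrightarrow>
       real (card {w\<in>\<Omega>. s < \<bar>Z w p - Z w q\<bar>}) * s\<^sup>2 \<le> real (card \<Omega>) * (dist p q)\<^sup>2"
    and "\<And>p q. p \<in> P \<Longrightarrow> q \<in> P \<Longrightarrow> p \<noteq> q \<Longrightarrow>
       3 / 16 * real (card \<Omega>) \<le> real (card {w\<in>\<Omega>. dist p q / 2 < \<bar>Z w p - Z w q\<bar>})"
proof -
  obtain E where fin: "finite E" and expand: "\<And>p. p \<in> P \<Longrightarrow> p = (\<Sum>e\<in>E. (e \<bullet> p) *\<^sub>R e)"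
    using finite_orthonormal_expansion[OF assms] by blast
  define Z where "Z = (\<lambda>w p. signed_sum E (\<lambda>e. e \<bullet> p) w)"
  have Zdiff: "Z w p - Z w q = signed_sum E (\<lambda>e. e \<bullet> (p - q)) w" for w p q
    by (simp add: Z_def signed_sum_def sum_subtractf inner_diff_right algebra_simps)
  have Parseval: "(\<Sum>e\<in>E. (e \<bullet> (p - q))\<^sup>2) = (dist p q)\<^sup>2" if "p \<in> P" "q \<in> P" for p q
  proof -
    have "p - q = (\<Sum>e\<in>E. (e \<bullet> p) *\<^sub>R e) - (\<Sum>e\<in>E. (e \<bullet> q) *\<^sub>R e)"
      using expand that by simp
    also have "\<dots> = (\<Sum>e\<in>E. (e \<bullet> (p - q)) *\<^sub>R e)"
      by (simp add: inner_diff_right scaleR_diff_left sum_subtractf)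
    finally have "(p - q) \<bullet> (p - q) = (\<Sum>e\<in>E. (e \<bullet> (p - q)) *\<^sub>R e) \<bullet> (p - q)" by simp
    then show ?thesis
      by (simp add: inner_sum_left dist_norm power2_eq_square power2_norm_eq_inner[unfolded power2_eq_square])
  qed
  have card: "real (card (Pow E)) = 2 ^ card E" using fin by (simp add: card_Pow)
  have second: "(\<Sum>w\<in>Pow E. (Z w p - Z w q)\<^sup>2) = real (card (Pow E)) * (dist p q)\<^sup>2"
    if "p \<in> P" "q \<in> P" for p q
    unfolding Zdiff signed_sum_second_moment[OF fin] Parseval[OF that] card ..
  have fourth: "(\<Sum>w\<in>Pow E. (Z w p - Z w q)^4) \<le> 3 * real (card (Pow E)) * ((dist p q)\<^sup>2)\<^sup>2"
    if "p \<in> P" "q \<in> P" for p q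
    using signed_sum_fourth_moment[OF fin, of "\<lambda>e. e \<bullet> (p - q)"]
    unfolding Zdiff Parseval[OF that] card .
  have spread: "3 / 16 * real (card (Pow E)) \<le> real (card {w\<in>Pow E. dist p q / 2 < \<bar>Z w p - Z w q\<bar>})"
    if "p \<in> P" "q \<in> P" "p \<noteq> q" for p q
    using that fin by (intro finite_Paley_Zygmund second fourth) auto
  have small: "real (card {w\<in>Pow E. K < \<bar>Z w p - Z w q\<bar>}) * K\<^sup>2 \<le> real (card (Pow E)) * (dist p q)\<^sup>2"
    if "p \<in> P" "q \<in> P" "0 < K" for p q K
    using finite_Chebyshev[of "Pow E" K "\<lambda>w. Z w p - Z w q"] fin that second by simp
  have "finite (Pow E)" "Pow E \<noteq> {}" using fin by auto
  then show ?thesis using small spread by (rule that[of "Pow E" Z])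
qed

section \<open>Concentration of functions with bounded displacement\<close>

context prob_space
begin

text \<open>Double counting of the pairs \<open>(w, x)\<close> with \<open>x \<in> E w\<close>. It exchanges "for most parameters \<open>w\<close>, most points
  \<open>x\<close>" with "for most points, most parameters", in the form of the two inequalities that follow.\<close>

lemma sum_prob_eq_integral_card:
  assumes "finite \<Omega>" and E: "\<And>w. w \<in> \<Omega> \<Longrightarrow> E w \<in> events"
  shows "(\<lambda>x. real (card {w\<in>\<Omega>. x \<in> E w})) \<in> borel_measurable M"
    and "integrable M (\<lambda>x. real (card {w\<in>\<Omega>. x \<in> E w}))"
    and "(\<Sum>w\<in>\<Omega>. prob (E w)) = (\<integral>x. real (card {w\<in>\<Omega>. x \<in> E w}) \<partial>M)"
proof -
  have eq: "real (card {w\<in>\<Omega>. x \<in> E w}) = (\<Sum>w\<in>\<Omega>. indicat_real (E w) x)" for x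
    using assms(1) by (simp add: indicator_def Int_def flip: sum.inter_filter)
  have int: "integrable M (indicat_real (E w))" if "w \<in> \<Omega>" for w
    using E[OF that] by (simp add: emeasure_eq_measure)
  show "(\<lambda>x. real (card {w\<in>\<Omega>. x \<in> E w})) \<in> borel_measurable M"
    unfolding eq using E by measurable
  show "integrable M (\<lambda>x. real (card {w\<in>\<Omega>. x \<in> E w}))"
    unfolding eq using int by simp
  show "(\<Sum>w\<in>\<Omega>. prob (E w)) = (\<integral>x. real (card {w\<in>\<Omega>. x \<in> E w}) \<partial>M)"
    unfolding eq using int E by simp
qed

lemma sum_prob_le_card:
  assumes "finite \<Omega>" and "\<And>w. w \<in> \<Omega> \<Longrightarrow> E w \<in> events"
    and "\<And>x. real (card {w\<in>\<Omega>. x \<in> E w}) \<le> s"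
  shows "(\<Sum>w\<in>\<Omega>. prob (E w)) \<le> s"
proof -
  have eq: "(\<Sum>w\<in>\<Omega>. prob (E w)) = (\<integral>x. real (card {w\<in>\<Omega>. x \<in> E w}) \<partial>M)"
    using assms(1,2) by (rule sum_prob_eq_integral_card(3))
  have int: "integrable M (\<lambda>x. real (card {w\<in>\<Omega>. x \<in> E w}))"
    using assms(1,2) by (rule sum_prob_eq_integral_card(2))
  show ?thesis
    unfolding eq using int assms(3) by (intro integral_le_const) auto
qed

lemma prob_card_ge_le:
  assumes "finite \<Omega>" and "\<And>w. w \<in> \<Omega> \<Longrightarrow> E w \<in> events" and "0 < s"
  shows "prob {x\<in>space M. s \<le> real (card {w\<in>\<Omega>. x \<in> E w})} \<le> (\<Sum>w\<in>\<Omega>. prob (E w)) / s"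
proof -
  have eq: "(\<Sum>w\<in>\<Omega>. prob (E w)) = (\<integral>x. real (card {w\<in>\<Omega>. x \<in> E w}) \<partial>M)"
    using assms(1,2) by (rule sum_prob_eq_integral_card(3))
  have int: "integrable M (\<lambda>x. real (card {w\<in>\<Omega>. x \<in> E w}))"
    using assms(1,2) by (rule sum_prob_eq_integral_card(2))
  show ?thesis
    unfolding eq using int assms(3)
    by (intro integral_Markov_inequality_measure[where A = "space M"]) auto
qed

text \<open>An approximate median, up to the error \<open>K\<close>, can be found by walking down from the upper bound of \<open>\<phi>\<close> in
  steps of length \<open>K\<close>; stopping just before the upper tail exceeds 1/2 leaves at most 1/2 for the
  lower tail one step further down.\<close>

lemma coarse_median:
  fixes \<phi> :: "'a \<Rightarrow> real"
  assumes [measurable]: "\<phi> \<in> borel_measurable M" and bnd: "\<And>x. \<bar>\<phi> x\<bar> \<le> b" and K: "0 < K"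
  shows "\<exists>m. prob {x\<in>space M. m < \<phi> x} \<le> 1/2 \<and> prob {x\<in>space M. \<phi> x < m - K} \<le> 1/2"
proof (rule ccontr)
  assume none: "\<not> ?thesis"
  have step: "prob {x\<in>space M. m - K < \<phi> x} \<le> 1/2" if "prob {x\<in>space M. m < \<phi> x} \<le> 1/2" for m
  proof (rule ccontr)
    assume big: "\<not> prob {x\<in>space M. m - K < \<phi> x} \<le> 1/2"
    have [measurable]: "{x\<in>space M. m - K < \<phi> x} \<in> events" by measurable
    have "prob {x\<in>space M. \<phi> x < m - K} \<le> prob (space M - {x\<in>space M. m - K < \<phi> x})"
      by (intro finite_measure_mono) auto
    also have "\<dots> \<le> 1/2" using big by (subst prob_compl) auto
    finally show False using none that by auto
  qed
  have all: "prob {x\<in>space M. b - real i * K < \<phi> x} \<le> 1/2" for i :: nat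
  proof (induction i)
    case 0
    have "\<phi> x \<le> b" for x using bnd[of x] by linarith
    then have empty: "{x\<in>space M. b < \<phi> x} = {}" by (auto simp: not_less)
    show ?case by (simp add: empty)
  next
    case (Suc i)
    then show ?case using step[OF Suc] by (simp add: algebra_simps)
  qed
  obtain i :: nat where "2 * b / K < real i" using reals_Archimedean2 by blast
  then have "2 * b < real i * K" using K by (simp add: field_simps)
  moreover have "- b \<le> \<phi> x" for x using bnd[of x] by linarith
  ultimately have "b - real i * K < \<phi> x" for x by (smt (verit))
  then have "{x\<in>space M. b - real i * K < \<phi> x} = space M" by blast
  then show False using all[of i] prob_space by simp
qed

end

lemma action_identity:
  assumes "group_action G UNIV act"
  shows "act \<one>\<^bsub>G\<^esub> x = x"
  using group_action.id_eq_one[OF assms] by (metis UNIV_I restrict_apply)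

lemma action_inverse:
  assumes "group_action G UNIV act" and "g \<in> carrier G"
  shows "act (inv\<^bsub>G\<^esub> g) (act g x) = x" and "act g (act (inv\<^bsub>G\<^esub> g) x) = x"
proof -
  interpret group_action G UNIV act by fact
  interpret group G using group_hom by (rule group_hom.axioms)
  show "act (inv\<^bsub>G\<^esub> g) (act g x) = x"
    using composition_rule[of x "inv\<^bsub>G\<^esub> g" g] assms by (simp add: action_identity[OF assms(1)])
  show "act g (act (inv\<^bsub>G\<^esub> g) x) = x"
    using composition_rule[of x g "inv\<^bsub>G\<^esub> g"] assms by (simp add: action_identity[OF assms(1)])
qed

text \<open>A random functional of a map with bounded displacement has bounded displacement only off an
  exceptional set of small measure, so real concentration has to tolerate such a set.\<close>

definition jump_set :: "('g, 'm) monoid_scheme \<Rightarrow> ('g \<Rightarrow> nat) \<Rightarrow> ('g \<Rightarrow> 'a \<Rightarrow> 'a) \<Rightarrow> nat \<Rightarrow> ('a \<Rightarrow> real) \<Rightarrow> real \<Rightarrow> 'a set" where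
  "jump_set G len act k \<phi> K = {x. \<exists>g\<in>length_ball G len k. K < \<bar>\<phi> (act g x) - \<phi> x\<bar>}"

text \<open>The core of the argument. If the tail beyond \<open>m + n K\<close> had measure at least \<open>\<alpha>\<close>, then all the superlevel
  sets at heights \<open>m + K\<close>, ..., \<open>m + n K\<close> would be in the range where the action expands. Each set is
  mapped by \<open>B\<^sub>k\<close> into the previous one, up to the jump set, so the measure grows by at least
  \<open>c \<alpha> / 2\<close> at every step downwards and exceeds 1/2 at height \<open>m\<close>.\<close>

lemma upper_tail_concentration:
  fixes \<nu> :: "'a::metric_space measure" and act :: "'g \<Rightarrow> 'a \<Rightarrow> 'a"
  assumes prob: "prob_space \<nu>" and sp: "space \<nu> = UNIV"
    and len: "proper_length_function G len" and act: "group_action G UNIV act"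
    and c: "0 < c" and \<alpha>: "0 < \<alpha>"
    and expand: "\<And>A. A \<in> sets \<nu> \<Longrightarrow> \<alpha> \<le> measure \<nu> A \<Longrightarrow> measure \<nu> A \<le> 1/2 \<Longrightarrow>
         measure \<nu> (\<Union>g\<in>length_ball G len k. act g ` A) > (1 + c) * measure \<nu> A"
    and \<phi>[measurable]: "\<phi> \<in> borel_measurable \<nu>"
    and J: "jump_set G len act k \<phi> K \<in> sets \<nu>" "measure \<nu> (jump_set G len act k \<phi> K) \<le> c * \<alpha> / 2"
    and K: "0 \<le> K" and m: "measure \<nu> {x. m < \<phi> x} \<le> 1/2" and n: "1 \<le> real n * (c * \<alpha>)"
  shows "measure \<nu> {x. m + real n * K < \<phi> x} < \<alpha>"
proof (rule ccontr)
  interpret prob_space \<nu> by fact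
  interpret act: group_action G UNIV act by fact
  interpret group G using act.group_hom by (rule group_hom.axioms)
  define A where "A = (\<lambda>i. {x. m + real i * K < \<phi> x})"
  have Am: "A i \<in> sets \<nu>" for i
  proof -
    have "{x\<in>space \<nu>. m + real i * K < \<phi> x} \<in> sets \<nu>" by measurable
    then show ?thesis by (simp add: A_def sp)
  qed
  have anti: "measure \<nu> (A j) \<le> measure \<nu> (A i)" if "i \<le> j" for i j
  proof (intro finite_measure_mono Am)
    have "real i * K \<le> real j * K" using that K by (intro mult_right_mono) auto
    then show "A j \<subseteq> A i" by (auto simp: A_def)
  qed
  assume "\<not> ?thesis"
  then have last: "\<alpha> \<le> measure \<nu> (A n)" by (simp add: A_def)
  have step: "measure \<nu> (A (Suc i)) + c * \<alpha> / 2 < measure \<nu> (A i)" if "i < n" for i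
  proof -
    have lo: "\<alpha> \<le> measure \<nu> (A (Suc i))" using anti[of "Suc i" n] that last by simp
    have hi: "measure \<nu> (A (Suc i)) \<le> 1/2" using anti[of 0 "Suc i"] m by (simp add: A_def)
    have "(\<Union>g\<in>length_ball G len k. act g ` A (Suc i)) \<subseteq> A i \<union> jump_set G len act k \<phi> K"
    proof clarify
      fix g x assume g: "g \<in> length_ball G len k" and x: "x \<in> A (Suc i)" and nj: "act g x \<notin> jump_set G len act k \<phi> K"
      have gc: "g \<in> carrier G" using g by (simp add: length_ball_def)
      have "inv\<^bsub>G\<^esub> g \<in> length_ball G len k"
        using g len by (auto simp: length_ball_def proper_length_function_def)
      with nj have "\<bar>\<phi> x - \<phi> (act g x)\<bar> \<le> K"
        using action_inverse(1)[OF act gc] by (force simp: jump_set_def)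
      then show "act g x \<in> A i" using x by (simp add: A_def algebra_simps)
    qed
    then have "measure \<nu> (\<Union>g\<in>length_ball G len k. act g ` A (Suc i)) \<le> measure \<nu> (A i \<union> jump_set G len act k \<phi> K)"
      using Am J by (intro finite_measure_mono) auto
    also have "\<dots> \<le> measure \<nu> (A i) + c * \<alpha> / 2"
      using measure_Un_le[OF Am J(1), of i] J(2) by simp
    finally have "(1 + c) * measure \<nu> (A (Suc i)) < measure \<nu> (A i) + c * \<alpha> / 2"
      using expand[OF Am lo hi] by simp
    moreover have "c * \<alpha> \<le> c * measure \<nu> (A (Suc i))" using c lo by simp
    ultimately show ?thesis by (simp add: algebra_simps)
  qed
  have "measure \<nu> (A i) + real i * (c * \<alpha> / 2) \<le> measure \<nu> (A 0)" if "i \<le> n" for i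
    using that
  proof (induction i)
    case (Suc i)
    have "real (Suc i) * (c * \<alpha> / 2) = real i * (c * \<alpha> / 2) + c * \<alpha> / 2"
      by (simp add: algebra_simps)
    then show ?case using Suc step[of i] by linarith
  qed simp
  from this[of n] have "\<alpha> + real n * (c * \<alpha> / 2) \<le> 1/2" using last m by (simp add: A_def)
  then show False using n \<alpha> by (simp add: algebra_simps)
qed

text \<open>Both tails are treated by the one-sided estimate, the lower one for \<open>- \<phi>\<close>; the extra step in
  \<open>Suc n\<close> absorbs the error of the approximate median.\<close>

lemma real_concentration:
  fixes \<nu> :: "'a::metric_space measure" and act :: "'g \<Rightarrow> 'a \<Rightarrow> 'a"
  assumes prob: "prob_space \<nu>" and sp: "space \<nu> = UNIV"
    and len: "proper_length_function G len" and act: "group_action G UNIV act"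
    and c: "0 < c" and \<alpha>: "0 < \<alpha>"
    and expand: "\<And>A. A \<in> sets \<nu> \<Longrightarrow> \<alpha> \<le> measure \<nu> A \<Longrightarrow> measure \<nu> A \<le> 1/2 \<Longrightarrow>
         measure \<nu> (\<Union>g\<in>length_ball G len k. act g ` A) > (1 + c) * measure \<nu> A"
    and \<phi>[measurable]: "\<phi> \<in> borel_measurable \<nu>" and bnd: "\<And>x. \<bar>\<phi> x\<bar> \<le> b"
    and J: "jump_set G len act k \<phi> K \<in> sets \<nu>" "measure \<nu> (jump_set G len act k \<phi> K) \<le> c * \<alpha> / 2"
    and K: "0 < K" and n: "1 \<le> real n * (c * \<alpha>)"
  shows "\<exists>m. measure \<nu> {x. real (Suc n) * K < \<bar>\<phi> x - m\<bar>} \<le> 2 * \<alpha>"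
proof -
  interpret prob_space \<nu> by fact
  obtain m where m: "measure \<nu> {x. m < \<phi> x} \<le> 1/2" "measure \<nu> {x. \<phi> x < m - K} \<le> 1/2"
    using coarse_median[OF \<phi> bnd K] by (auto simp: sp)
  have up: "measure \<nu> {x. m + real n * K < \<phi> x} < \<alpha>"
    using K by (intro upper_tail_concentration[OF prob sp len act c \<alpha> expand \<phi> J _ m(1) n]) auto
  have neg: "jump_set G len act k (\<lambda>x. - \<phi> x) K = jump_set G len act k \<phi> K"
    by (simp add: jump_set_def abs_minus_commute)
  have "measure \<nu> {x. (K - m) + real n * K < - \<phi> x} < \<alpha>"
  proof (rule upper_tail_concentration[OF prob sp len act c \<alpha> expand _ _ _ _ _ n])
    have "{x. K - m < - \<phi> x} = {x. \<phi> x < m - K}" by auto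
    then show "measure \<nu> {x. K - m < - \<phi> x} \<le> 1/2" using m(2) by simp
  qed (use J K neg in auto)
  moreover have [measurable]: "{x. m + real n * K < \<phi> x} \<in> sets \<nu>" "{x. (K - m) + real n * K < - \<phi> x} \<in> sets \<nu>"
  proof -
    have "{x\<in>space \<nu>. m + real n * K < \<phi> x} \<in> sets \<nu>" "{x\<in>space \<nu>. (K - m) + real n * K < - \<phi> x} \<in> sets \<nu>"
      by measurable
    then show "{x. m + real n * K < \<phi> x} \<in> sets \<nu>" "{x. (K - m) + real n * K < - \<phi> x} \<in> sets \<nu>"
      by (simp_all add: sp)
  qed
  moreover have "{x. real (Suc n) * K < \<bar>\<phi> x - m\<bar>} \<subseteq>
      {x. m + real n * K < \<phi> x} \<union> {x. (K - m) + real n * K < - \<phi> x}"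
    using K by (auto simp: algebra_simps)
  ultimately have "measure \<nu> {x. real (Suc n) * K < \<bar>\<phi> x - m\<bar>} \<le> \<alpha> + \<alpha>"
    using up finite_measure_mono[of "{x. real (Suc n) * K < \<bar>\<phi> x - m\<bar>}" "{x. m + real n * K < \<phi> x} \<union> {x. (K - m) + real n * K < - \<phi> x}"]
      measure_Un_le[of "{x. m + real n * K < \<phi> x}" \<nu> "{x. (K - m) + real n * K < - \<phi> x}"]
    by (simp add: sets.Un)
  then show ?thesis by (intro exI[of _ m]) simp
qed

text \<open>Composing \<open>f\<close> with the random functionals \<open>Z w\<close> gives real functions which have small jump sets, and hence
  concentrate around some \<open>m w\<close>, for most \<open>w\<close>. By double counting, for at least half of the points \<open>x\<close>,
  the value \<open>Z w (f x)\<close> is close to \<open>m w\<close> for most \<open>w\<close>. Two such points have close values under most functionals, which by the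
  Paley-Zygmund bound is impossible if their images under \<open>f\<close> are far apart. The radius \<open>k\<close> does not depend on
  \<open>L\<close>, so that \<open>L\<close> can later be computed from the displacement of the map under elements of length at most
  \<open>k\<close>. Maps with finite range suffice, which avoids questions of measurability
  in a possibly non-separable target.\<close>

lemma Hilbert_concentration:
  fixes \<nu> :: "'a::metric_space measure" and act :: "'g \<Rightarrow> 'a \<Rightarrow> 'a"
  assumes prob: "prob_space \<nu>" and borel: "sets \<nu> = sets borel"
    and len: "proper_length_function G len" and act: "group_action G UNIV act"
    and cont: "\<forall>g\<in>carrier G. continuous_on UNIV (act g)"
    and exp: "asymptotically_expanding G len act \<nu>"
  shows "\<exists>k. \<forall>L. \<exists>R. \<forall>f :: 'a \<Rightarrow> 'h::real_inner.
    finite (range f) \<longrightarrow> f \<in> \<nu> \<rightarrow>\<^sub>M count_space UNIV \<longrightarrow>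
    (\<forall>g\<in>length_ball G len k. \<forall>x. dist (f (act g x)) (f x) \<le> L) \<longrightarrow>
    (\<exists>Y\<in>sets \<nu>. 1/2 \<le> measure \<nu> Y \<and> (\<forall>x\<in>Y. \<forall>y\<in>Y. dist (f x) (f y) \<le> R))"
proof -
  interpret prob_space \<nu> by fact
  have sp: "space \<nu> = UNIV" using sets_eq_imp_space_eq[OF borel] by simp
  \<comment> \<open>At the end, two points of \<open>Y\<close> share a proportion of at least \<open>1 - 12 \<alpha>\<close> of good functionals,
    so any \<open>\<alpha>\<close> with \<open>12 \<alpha> < 3/16\<close> is small enough.\<close>
  define \<alpha> :: real where "\<alpha> = 1/100"
  have \<alpha>: "0 < \<alpha>" "\<alpha> \<le> 1/2" by (auto simp: \<alpha>_def)
  obtain c :: real and k where c: "0 < c"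
    and expand: "\<And>A. A \<in> sets \<nu> \<Longrightarrow> \<alpha> \<le> measure \<nu> A \<Longrightarrow> measure \<nu> A \<le> 1/2 \<Longrightarrow>
         measure \<nu> (\<Union>g\<in>length_ball G len k. act g ` A) > (1 + c) * measure \<nu> A"
    using exp \<alpha> unfolding asymptotically_expanding_def by meson
  define B where "B = length_ball G len k"
  have B: "finite B" "B \<subseteq> carrier G"
    using len by (auto simp: B_def length_ball_def proper_length_function_def)
  define \<eta> where "\<eta> = c * \<alpha> / 2"
  have \<eta>: "0 < \<eta>" using c \<alpha> by (simp add: \<eta>_def)
  obtain n :: nat where "1 / (c * \<alpha>) < real n" using reals_Archimedean2 by blast
  then have n: "1 \<le> real n * (c * \<alpha>)" using c \<alpha> by (simp add: field_simps)
  show ?thesis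
  proof (rule exI[of _ k], rule allI)
    fix L :: real
    \<comment> \<open>Chebyshev's inequality, summed over the ball, then bounds the proportion of functionals that
      jump by more than \<open>K\<close> at a given point by \<open>\<alpha> \<eta>\<close>; the summand 1 makes \<open>K \<le> K\<^sup>2\<close>.\<close>
    define K where "K = 1 + real (card B) * L\<^sup>2 / (\<alpha> * \<eta>)"
    have K1: "1 \<le> K" using \<alpha> \<eta> by (simp add: K_def)
    then have K0: "0 < K" by simp
    have "real (card B) * L\<^sup>2 / (\<alpha> * \<eta>) \<le> K" by (simp add: K_def)
    also have "K \<le> K * K" using mult_right_mono[OF K1, of K] K1 by simp
    finally have "real (card B) * L\<^sup>2 / (\<alpha> * \<eta>) \<le> K * K" .
    then have K: "real (card B) * L\<^sup>2 \<le> \<alpha> * \<eta> * K\<^sup>2"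
      using \<alpha> \<eta> by (simp add: field_simps power2_eq_square)
    define N where "N = real (Suc n) * K"
    show "\<exists>R. \<forall>f :: 'a \<Rightarrow> 'h.
      finite (range f) \<longrightarrow> f \<in> \<nu> \<rightarrow>\<^sub>M count_space UNIV \<longrightarrow>
      (\<forall>g\<in>length_ball G len k. \<forall>x. dist (f (act g x)) (f x) \<le> L) \<longrightarrow>
      (\<exists>Y\<in>sets \<nu>. 1/2 \<le> measure \<nu> Y \<and> (\<forall>x\<in>Y. \<forall>y\<in>Y. dist (f x) (f y) \<le> R))"
    proof (rule exI[of _ "4 * N"], intro allI impI)
      fix f :: "'a \<Rightarrow> 'h"
      assume fin: "finite (range f)" and f: "f \<in> \<nu> \<rightarrow>\<^sub>M count_space UNIV"
        and disp: "\<forall>g\<in>length_ball G len k. \<forall>x. dist (f (act g x)) (f x) \<le> L"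
      obtain \<Omega> :: "'h set set" and Z where \<Omega>: "finite \<Omega>" "\<Omega> \<noteq> {}"
        and Cheb: "\<And>p q s. p \<in> range f \<Longrightarrow> q \<in> range f \<Longrightarrow> 0 < s \<Longrightarrow>
            real (card {w\<in>\<Omega>. s < \<bar>Z w p - Z w q\<bar>}) * s\<^sup>2 \<le> real (card \<Omega>) * (dist p q)\<^sup>2"
        and PZ: "\<And>p q. p \<in> range f \<Longrightarrow> q \<in> range f \<Longrightarrow> p \<noteq> q \<Longrightarrow>
            3 / 16 * real (card \<Omega>) \<le> real (card {w\<in>\<Omega>. dist p q / 2 < \<bar>Z w p - Z w q\<bar>})"
        using fin by (rule finite_random_functionals) (rule that)
      define \<omega> where "\<omega> = real (card \<Omega>)"
      have \<omega>: "0 < \<omega>" using \<Omega> by (simp add: \<omega>_def card_gt_0_iff)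
      define \<phi> where "\<phi> = (\<lambda>w x. Z w (f x))"
      have \<phi>[measurable]: "\<phi> w \<in> borel_measurable \<nu>" for w
        unfolding \<phi>_def by (rule measurable_compose[OF f]) simp
      have \<phi>_bnd: "\<exists>b. \<forall>x. \<bar>\<phi> w x\<bar> \<le> b" for w
      proof -
        have "finite (range (\<phi> w))" using finite_imageI[OF fin, of "Z w"] by (simp add: \<phi>_def image_image)
        then have "bounded (range (\<phi> w))" by (rule finite_imp_bounded)
        then show ?thesis by (auto simp: bounded_iff)
      qed
      define J where "J = (\<lambda>w. jump_set G len act k (\<phi> w) K)"
      have J: "J w \<in> sets \<nu>" for w
      proof -
        have "{x. K < \<bar>\<phi> w (act g x) - \<phi> w x\<bar>} \<in> sets \<nu>" if "g \<in> B" for g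
        proof -
          have "act g \<in> borel_measurable borel"
            using cont B that by (intro borel_measurable_continuous_onI) auto
          then have [measurable]: "act g \<in> \<nu> \<rightarrow>\<^sub>M \<nu>" using measurable_cong_sets[OF borel borel] by blast
          have "{x\<in>space \<nu>. K < \<bar>\<phi> w (act g x) - \<phi> w x\<bar>} \<in> sets \<nu>" by measurable
          then show ?thesis by (simp add: sp)
        qed
        moreover have "J w = (\<Union>g\<in>B. {x. K < \<bar>\<phi> w (act g x) - \<phi> w x\<bar>})"
          by (auto simp: J_def jump_set_def B_def)
        ultimately show ?thesis using B by auto
      qed
      have card_J: "real (card {w\<in>\<Omega>. x \<in> J w}) \<le> \<alpha> * \<eta> * \<omega>" for x
      proof -
        let ?D = "\<lambda>g. {w\<in>\<Omega>. K < \<bar>Z w (f (act g x)) - Z w (f x)\<bar>}"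
        have "{w\<in>\<Omega>. x \<in> J w} = (\<Union>g\<in>B. ?D g)"
          by (auto simp: J_def jump_set_def B_def \<phi>_def)
        then have "real (card {w\<in>\<Omega>. x \<in> J w}) \<le> (\<Sum>g\<in>B. real (card (?D g)))"
          using card_UN_le[OF B(1), of ?D] by (simp flip: of_nat_sum)
        also have "\<dots> \<le> (\<Sum>g\<in>B. \<omega> * L\<^sup>2 / K\<^sup>2)"
        proof (rule sum_mono)
          fix g assume "g \<in> B"
          then have "(dist (f (act g x)) (f x))\<^sup>2 \<le> L\<^sup>2"
            using disp by (intro power_mono) (auto simp: B_def)
          then have "\<omega> * (dist (f (act g x)) (f x))\<^sup>2 \<le> \<omega> * L\<^sup>2" using \<omega> by simp
          moreover have "real (card (?D g)) * K\<^sup>2 \<le> \<omega> * (dist (f (act g x)) (f x))\<^sup>2"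
            using Cheb[of "f (act g x)" "f x" K] K0 by (simp add: \<omega>_def)
          ultimately show "real (card (?D g)) \<le> \<omega> * L\<^sup>2 / K\<^sup>2"
            using K0 by (simp add: field_simps)
        qed
        also have "\<dots> = (real (card B) * L\<^sup>2) * \<omega> / K\<^sup>2" by simp
        also have "\<dots> \<le> (\<alpha> * \<eta> * K\<^sup>2) * \<omega> / K\<^sup>2"
          using K \<omega> by (intro divide_right_mono mult_right_mono) auto
        also have "\<dots> = \<alpha> * \<eta> * \<omega>" using K0 by simp
        finally show ?thesis .
      qed
      define bad where "bad = {w\<in>\<Omega>. \<eta> < measure \<nu> (J w)}"
      have bad: "real (card bad) \<le> \<alpha> * \<omega>"
      proof -
        have "real (card bad) * \<eta> = (\<Sum>w\<in>bad. \<eta>)" by simp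
        also have "\<dots> \<le> (\<Sum>w\<in>bad. measure \<nu> (J w))" by (rule sum_mono) (auto simp: bad_def)
        also have "\<dots> \<le> (\<Sum>w\<in>\<Omega>. measure \<nu> (J w))"
          using \<Omega> by (intro sum_mono2) (auto simp: bad_def)
        also have "\<dots> \<le> \<alpha> * \<eta> * \<omega>" using \<Omega>(1) J card_J by (rule sum_prob_le_card)
        finally show ?thesis using \<eta> by (simp add: mult.commute mult.left_commute)
      qed
      have "\<exists>m. measure \<nu> {x. N < \<bar>\<phi> w x - m\<bar>} \<le> 2 * \<alpha>" if "w \<in> \<Omega> - bad" for w
      proof -
        obtain b where "\<And>x. \<bar>\<phi> w x\<bar> \<le> b" using \<phi>_bnd by blast
        then show ?thesis
          unfolding N_def using that J[of w]
          by (intro real_concentration[OF prob sp len act c \<alpha>(1) expand \<phi> _ _ _ K0 n])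
            (auto simp: bad_def J_def \<eta>_def)
      qed
      then obtain m where m: "\<And>w. w \<in> \<Omega> - bad \<Longrightarrow> measure \<nu> {x. N < \<bar>\<phi> w x - m w\<bar>} \<le> 2 * \<alpha>"
        by metis
      \<comment> \<open>For a bad functional, for which concentration is not known, every point counts as exceptional.\<close>
      define E where "E = (\<lambda>w. if w \<in> bad then UNIV else {x. N < \<bar>\<phi> w x - m w\<bar>})"
      have E: "E w \<in> sets \<nu>" for w
      proof -
        have "{x\<in>space \<nu>. N < \<bar>\<phi> w x - m w\<bar>} \<in> sets \<nu>" by measurable
        then show ?thesis using sets.top[of \<nu>] by (simp add: E_def sp)
      qed
      have sum_E: "(\<Sum>w\<in>\<Omega>. measure \<nu> (E w)) \<le> 3 * \<alpha> * \<omega>"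
      proof -
        have "(\<Sum>w\<in>\<Omega>. measure \<nu> (E w)) \<le> (\<Sum>w\<in>\<Omega>. (if w \<in> bad then 1 else 0) + 2 * \<alpha>)"
          using m \<alpha> by (intro sum_mono) (auto simp: E_def intro: add_increasing2)
        also have "\<dots> = real (card bad) + 2 * \<alpha> * \<omega>"
        proof -
          have "{w\<in>\<Omega>. w \<in> bad} = bad" by (auto simp: bad_def)
          then have "(\<Sum>w\<in>\<Omega>. if w \<in> bad then 1 else 0 :: real) = real (card bad)"
            using \<Omega> by (simp flip: sum.inter_filter)
          then show ?thesis by (simp add: sum.distrib \<omega>_def)
        qed
        finally show ?thesis using bad by simp
      qed
      define C where "C = (\<lambda>x. real (card {w\<in>\<Omega>. x \<in> E w}))"
      have Cm: "C \<in> borel_measurable \<nu>"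
        unfolding C_def using \<Omega>(1) E by (rule sum_prob_eq_integral_card(1))
      define Y where "Y = {x. C x < 6 * \<alpha> * \<omega>}"
      have Ym: "Y \<in> sets \<nu>"
      proof -
        have "{x\<in>space \<nu>. C x < 6 * \<alpha> * \<omega>} \<in> sets \<nu>" using Cm by measurable
        then show ?thesis by (simp add: Y_def sp)
      qed
      have "measure \<nu> (- Y) \<le> (\<Sum>w\<in>\<Omega>. measure \<nu> (E w)) / (6 * \<alpha> * \<omega>)"
      proof -
        have "- Y = {x\<in>space \<nu>. 6 * \<alpha> * \<omega> \<le> C x}" by (auto simp: Y_def sp)
        moreover have "measure \<nu> {x\<in>space \<nu>. 6 * \<alpha> * \<omega> \<le> C x} \<le> (\<Sum>w\<in>\<Omega>. measure \<nu> (E w)) / (6 * \<alpha> * \<omega>)"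
          unfolding C_def using \<Omega>(1) E by (rule prob_card_ge_le) (use \<alpha> \<omega> in auto)
        ultimately show ?thesis by simp
      qed
      also have "\<dots> \<le> 1/2" using sum_E \<alpha> \<omega> by (simp add: field_simps)
      finally have "1/2 \<le> measure \<nu> Y"
        using prob_compl[OF Ym] by (simp add: sp Compl_eq_Diff_UNIV)
      moreover have "dist (f x) (f y) \<le> 4 * N" if "x \<in> Y" "y \<in> Y" for x y
      proof (rule ccontr)
        assume far: "\<not> dist (f x) (f y) \<le> 4 * N"
        have "0 \<le> N" using K0 by (simp add: N_def)
        with far have ne: "f x \<noteq> f y" by auto
        have sub: "{w\<in>\<Omega>. dist (f x) (f y) / 2 < \<bar>Z w (f x) - Z w (f y)\<bar>} \<subseteq>
          {w\<in>\<Omega>. x \<in> E w} \<union> {w\<in>\<Omega>. y \<in> E w}"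
        proof clarify
          fix w assume w: "w \<in> \<Omega>" "dist (f x) (f y) / 2 < \<bar>Z w (f x) - Z w (f y)\<bar>" "y \<notin> E w"
          show "x \<in> E w"
          proof (rule ccontr)
            assume "x \<notin> E w"
            with w(3) have "\<bar>Z w (f x) - m w\<bar> \<le> N" "\<bar>Z w (f y) - m w\<bar> \<le> N"
              by (auto simp: E_def \<phi>_def split: if_splits)
            then have "\<bar>Z w (f x) - Z w (f y)\<bar> \<le> 2 * N" by linarith
            then show False using w(2) far by linarith
          qed
        qed
        have "3 / 16 * \<omega> \<le> real (card {w\<in>\<Omega>. dist (f x) (f y) / 2 < \<bar>Z w (f x) - Z w (f y)\<bar>})"
          unfolding \<omega>_def using ne by (intro PZ) auto
        also have "\<dots> \<le> real (card ({w\<in>\<Omega>. x \<in> E w} \<union> {w\<in>\<Omega>. y \<in> E w}))"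
          using \<Omega> by (intro of_nat_mono card_mono sub) auto
        also have "\<dots> \<le> C x + C y"
          unfolding C_def using of_nat_mono[OF card_Un_le, of "{w\<in>\<Omega>. x \<in> E w}" "{w\<in>\<Omega>. y \<in> E w}"] by simp
        also have "\<dots> < 12 * \<alpha> * \<omega>" using that by (simp add: Y_def)
        finally show False using \<omega> by (simp add: \<alpha>_def)
      qed
      ultimately show "\<exists>Y\<in>sets \<nu>. 1/2 \<le> measure \<nu> Y \<and> (\<forall>x\<in>Y. \<forall>y\<in>Y. dist (f x) (f y) \<le> 4 * N)"
        using Ym by blast
    qed
  qed
qed

section \<open>Divergence of the warped metrics off the orbits\<close>

text \<open>A uniformly continuous bounded function is within distance 1 of a Lipschitz function; the Lipschitz
  constant \<open>s\<close> has to be large enough that moving by the modulus \<open>r\<close> costs as much as the whole range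
  of \<open>u\<close>.\<close>

lemma infimal_convolution:
  fixes u :: "'a::metric_space \<Rightarrow> real"
  assumes u: "\<And>z. 0 \<le> u z" "\<And>z. u z \<le> n" and r: "0 < r"
    and unif: "\<And>z w. dist z w < r \<Longrightarrow> \<bar>u z - u w\<bar> \<le> 1" and s: "0 \<le> s" "n \<le> s * r"
  shows "\<exists>v. (\<forall>z. u z - 1 \<le> v z \<and> v z \<le> u z) \<and> (\<forall>z w. \<bar>v z - v w\<bar> \<le> s * dist z w)"
proof -
  define v where "v = (\<lambda>z. INF w. u w + s * dist z w)"
  have bdd: "bdd_below (range (\<lambda>w. u w + s * dist z w))" for z
    using u s by (intro bdd_belowI[of _ 0]) auto
  have upper: "v z \<le> u w + s * dist z w" for z w
    unfolding v_def by (rule cINF_lower[OF bdd]) simp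
  have least: "c \<le> v z" if "\<And>w. c \<le> u w + s * dist z w" for c z
    unfolding v_def using that by (intro cINF_greatest) auto
  have "u z - 1 \<le> v z" for z
  proof (rule least)
    fix w
    show "u z - 1 \<le> u w + s * dist z w"
    proof (cases "dist z w < r")
      case True
      then have "u z - 1 \<le> u w" using unif[OF True] by linarith
      moreover have "0 \<le> s * dist z w" using s by simp
      ultimately show ?thesis by linarith
    next
      case False
      then have "s * r \<le> s * dist z w" using s by (intro mult_left_mono) auto
      then show ?thesis using u(1)[of w] u(2)[of z] s by linarith
    qed
  qed
  moreover have "v z \<le> u z" for z using upper[of z z] by simp
  moreover have one: "v z \<le> v w + s * dist z w" for z w
  proof -
    have "v z - s * dist z w \<le> v w"
    proof (rule least)
      fix y
      have "s * dist z y \<le> s * dist z w + s * dist w y"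
        using mult_left_mono[OF dist_triangle[of z y w] s(1)] by (simp add: algebra_simps)
      then show "v z - s * dist z w \<le> u y + s * dist w y" using upper[of z y] by linarith
    qed
    then show ?thesis by linarith
  qed
  moreover have "\<bar>v z - v w\<bar> \<le> s * dist z w" for z w
    using one[of z w] one[of w z] by (simp add: dist_commute)
  ultimately show ?thesis by blast
qed

text \<open>The function is \<open>u z = min n (MIN g. len g + T * dist (g z) x)\<close>, with \<open>g\<close> ranging over the ball of
  radius \<open>n\<close>: the cost, capped at \<open>n\<close>, of moving \<open>z\<close> by a group element and then going to \<open>x\<close> inside the
  metric space at a high price \<open>T\<close>. Subadditivity of the length makes it 1-Lipschitz along
  orbits, while the cap leaves only finitely many group elements in the minimum and so makes it
  continuous. As no group element takes \<open>y\<close> to \<open>x\<close>, a large \<open>T\<close> forces \<open>u y = n\<close>.\<close>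

lemma orbit_lipschitz_separation:
  fixes act :: "'g \<Rightarrow> 'a::metric_space \<Rightarrow> 'a"
  assumes act: "group_action G UNIV act" and len: "proper_length_function G len"
    and cont: "\<forall>g\<in>carrier G. continuous_on UNIV (act g)"
    and y: "\<And>g. g \<in> carrier G \<Longrightarrow> act g y \<noteq> x"
  shows "\<exists>u. u x = 0 \<and> u y = real n \<and> (\<forall>z. 0 \<le> u z \<and> u z \<le> real n) \<and> continuous_on UNIV u \<and>
    (\<forall>z. \<forall>g\<in>carrier G. \<bar>u z - u (act g z)\<bar> \<le> real (len g))"
proof -
  interpret group_action G UNIV act by fact
  interpret group G using group_hom by (rule group_hom.axioms)
  note ai = action_inverse[OF act]
  have len1: "len \<one>\<^bsub>G\<^esub> = 0"
    and leninv: "\<And>g. g \<in> carrier G \<Longrightarrow> len (inv\<^bsub>G\<^esub> g) = len g"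
    and lenmult: "\<And>g h. g \<in> carrier G \<Longrightarrow> h \<in> carrier G \<Longrightarrow> len (g \<otimes>\<^bsub>G\<^esub> h) \<le> len g + len h"
    and finball: "finite (length_ball G len n)"
    using len by (auto simp: proper_length_function_def length_ball_def)
  define B where "B = length_ball G len n"
  have B: "finite B" "\<one>\<^bsub>G\<^esub> \<in> B" "B \<subseteq> carrier G" "B \<noteq> {}"
    using finball len1 by (auto simp: B_def length_ball_def)
  define m where "m = Min ((\<lambda>g. dist (act g y) x) ` B)"
  have "m \<in> (\<lambda>g. dist (act g y) x) ` B" unfolding m_def using B by (intro Min_in) auto
  then have m: "0 < m" using y B by auto
  have m_le: "m \<le> dist (act g y) x" if "g \<in> B" for g
    unfolding m_def using B that by simp
  \<comment> \<open>The least price at which going from \<open>act g y\<close> to \<open>x\<close> costs at least \<open>n\<close> for every \<open>g\<close> in the ball.\<close>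
  define T where "T = real n / m"
  have T: "0 \<le> T" using m by (simp add: T_def)
  define u where "u = (\<lambda>z. min (real n) (Min ((\<lambda>g. real (len g) + T * dist (act g z) x) ` B)))"
  have u_le: "u z \<le> real (len g) + T * dist (act g z) x" if "g \<in> B" for g z
    unfolding u_def using B that by (intro min.coboundedI2 Min_le) auto
  have u_n: "u z \<le> real n" for z unfolding u_def by simp
  have u_ge: "c \<le> u z" if "c \<le> real n" "\<And>g. g \<in> B \<Longrightarrow> c \<le> real (len g) + T * dist (act g z) x" for c z
    unfolding u_def using that B by (auto intro!: min.boundedI)
  have u_0: "0 \<le> u z" for z using T by (intro u_ge) auto
  have "u x = 0"
    using u_le[OF B(2), of x] u_0[of x] len1 by (simp add: action_identity[OF act])
  moreover have "u y = real n"
  proof (rule antisym[OF u_n u_ge])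
    fix g assume "g \<in> B"
    from mult_left_mono[OF m_le[OF this] T] have "real n \<le> T * dist (act g y) x"
      using m by (simp add: T_def)
    then show "real n \<le> real (len g) + T * dist (act g y) x" by simp
  qed simp
  moreover have one: "u z \<le> real (len g) + u (act g z)" if g: "g \<in> carrier G" for z g
  proof -
    have "u z - real (len g) \<le> u (act g z)"
    proof (rule u_ge)
      show "u z - real (len g) \<le> real n" using u_n[of z] by simp
      fix h assume h: "h \<in> B"
      then have hc: "h \<in> carrier G" using B by auto
      have comp: "act (h \<otimes>\<^bsub>G\<^esub> g) z = act h (act g z)" using composition_rule hc g by simp
      have lm: "real (len (h \<otimes>\<^bsub>G\<^esub> g)) \<le> real (len h) + real (len g)" 
        using lenmult[OF hc g] by linarith
      have "0 \<le> T * dist (act h (act g z)) x" using T by simp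
      moreover have "u z \<le> real (len h) + real (len g) + T * dist (act h (act g z)) x"
      proof (cases "h \<otimes>\<^bsub>G\<^esub> g \<in> B")
        case True
        from u_le[OF this, of z] show ?thesis using lm by (simp add: comp)
      next
        case False
        \<comment> \<open>Here the product leaves the ball, and the cap makes the estimate trivial.\<close>
        then have "n < len (h \<otimes>\<^bsub>G\<^esub> g)" using hc g by (simp add: B_def length_ball_def)
        then have "real n \<le> real (len (h \<otimes>\<^bsub>G\<^esub> g))" by simp
        moreover have "0 \<le> T * dist (act h (act g z)) x" using T by simp
        ultimately show ?thesis using u_n[of z] lm by linarith
      qed
      ultimately show "u z - real (len g) \<le> real (len h) + T * dist (act h (act g z)) x" by simp
    qed
    then show ?thesis by simp
  qed
  moreover have "\<bar>u z - u (act g z)\<bar> \<le> real (len g)" if g: "g \<in> carrier G" for z g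
    using one[OF g, of z] one[OF inv_closed[OF g], of "act g z"] ai(1)[OF g] leninv[OF g] by simp
  moreover have "continuous_on UNIV u"
  proof -
    have "continuous_on UNIV (\<lambda>z. Min ((\<lambda>g. real (len g) + T * dist (act g z) x) ` C))"
      if "finite C" "C \<noteq> {}" "C \<subseteq> B" for C
      using that
    proof (induction rule: finite_ne_induct)
      case (singleton g)
      then show ?case using cont B by (auto intro!: continuous_intros)
    next
      case (insert g C)
      have "continuous_on UNIV (\<lambda>z. real (len g) + T * dist (act g z) x)"
        using insert cont B by (auto intro!: continuous_intros)
      then show ?case using insert by (simp add: continuous_on_min)
    qed
    then show ?thesis unfolding u_def using B by (intro continuous_intros) auto
  qed
  ultimately show ?thesis using u_0 u_n by blast
qed

lemma warped_dist_le:
  fixes act :: "'g \<Rightarrow> 'a::metric_space \<Rightarrow> 'a"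
  assumes "group_action G UNIV act" "proper_length_function G len"
    "bounded (UNIV::'a set)" "diameter (UNIV::'a set) \<le> 2" "1 \<le> t"
  shows "warped_dist G len act t x y \<le> t * dist x y"
    and "g \<in> carrier G \<Longrightarrow> warped_dist G len act t x (act g x) \<le> real (len g)"
    and "0 \<le> warped_dist G len act t x y"
    and "warped_dist G len act t x y = warped_dist G len act t y x"
    and "warped_dist G len act t x z \<le> warped_dist G len act t x y + warped_dist G len act t y z"
  using warped_dist_greatest(1)[OF assms]
  by (auto simp: warp_admissible_def Metric_space.nonneg Metric_space.commute 
      intro: Metric_space.triangle)

text \<open>A larger \<open>t\<close> weakens the constraint \<open>\<delta> \<le> t d\<close>, so there are more admissible metrics to compete.\<close>

lemma warped_dist_mono:
  fixes act :: "'g \<Rightarrow> 'a::metric_space \<Rightarrow> 'a"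
  assumes "group_action G UNIV act" "proper_length_function G len"
    "bounded (UNIV::'a set)" "diameter (UNIV::'a set) \<le> 2" "1 \<le> s" "s \<le> t"
  shows "warped_dist G len act s x y \<le> warped_dist G len act t x y"
proof -
  have t: "1 \<le> t" using assms by simp
  have "warp_admissible G len act t (warped_dist G len act s)"
    unfolding warp_admissible_def
  proof (intro conjI allI ballI)
    show "Metric_space UNIV (warped_dist G len act s)"
      using warped_dist_greatest(1)[OF assms(1-5)] by (simp add: warp_admissible_def)
    fix x y
    have "warped_dist G len act s x y \<le> s * dist x y" by (rule warped_dist_le[OF assms(1-5)])
    also have "\<dots> \<le> t * dist x y" using assms(6) by (intro mult_right_mono) auto
    finally show "warped_dist G len act s x y \<le> t * dist x y" .
  qed (rule warped_dist_le[OF assms(1-5)])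
  from warped_dist_greatest(2)[OF assms(1-4) t this] show ?thesis by (simp add: le_fun_def)
qed

text \<open>As the warped metric dominates every admissible metric, it suffices to exhibit one
  admissible metric that separates \<open>x\<close> from \<open>y\<close>. Replacing the function \<open>u\<close> of
  \<open>orbit_lipschitz_separation\<close> by a
  Lipschitz function \<open>v\<close> within distance 1 costs an additive 1 along orbits, which is absorbed by halving
  because every nontrivial group element has length at least 1.\<close>

lemma warped_dist_unbounded:
  fixes act :: "'g \<Rightarrow> 'a::metric_space \<Rightarrow> 'a"
  assumes comp: "compact (UNIV::'a set)" and diam: "diameter (UNIV::'a set) \<le> 2"
    and act: "group_action G UNIV act" and len: "proper_length_function G len"
    and cont: "\<forall>g\<in>carrier G. continuous_on UNIV (act g)"
    and y: "\<And>g. g \<in> carrier G \<Longrightarrow> act g y \<noteq> x"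
  shows "\<exists>N::nat. 1 \<le> N \<and> S < warped_dist G len act (real N) x y"
proof -
  note bdd = compact_imp_bounded[OF comp]
  obtain n :: nat where n: "2 * S + 1 < real n" using reals_Archimedean2 by blast
  obtain u where ux: "u x = 0" and uy: "u y = real n" and u0: "\<And>z. 0 \<le> u z" and un: "\<And>z. u z \<le> real n"
    and cu: "continuous_on UNIV u"
    and ug: "\<And>z g. g \<in> carrier G \<Longrightarrow> \<bar>u z - u (act g z)\<bar> \<le> real (len g)"
    using orbit_lipschitz_separation[OF act len cont y, of n] by blast
  have "uniformly_continuous_on UNIV u" using compact_uniformly_continuous[OF cu comp] .
  then obtain r where r: "0 < r" and unif: "\<And>z w. dist z w < r \<Longrightarrow> dist (u z) (u w) < 1"
    unfolding uniformly_continuous_on_def by (metis UNIV_I zero_less_one)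
  obtain N0 :: nat where N0: "real n / r < real N0" using reals_Archimedean2 by blast
  define N where "N = Suc N0"
  have N: "1 \<le> real N" "real n \<le> real N * r" using N0 r by (auto simp: N_def field_simps)
  have unif': "\<bar>u z - u w\<bar> \<le> 1" if "dist z w < r" for z w using unif[OF that] by (simp add: dist_real_def)
  obtain v where v: "\<And>z. u z - 1 \<le> v z" "\<And>z. v z \<le> u z"
    and vl: "\<And>z w. \<bar>v z - v w\<bar> \<le> real N * dist z w"
    using infimal_convolution[of u "real n" r "real N", OF u0 un r unif' _ N(2)] N(1) by auto
  \<comment> \<open>The second entry of the maximum only serves to make \<open>\<delta>\<close> positive off the diagonal.\<close>
  define \<delta> where "\<delta> = (\<lambda>z w. max (\<bar>v z - v w\<bar> / 2) (dist z w / 2))"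
  note half = warp_admissible_half_dist[OF act len bdd diam N(1)]
  have "warp_admissible G len act (real N) \<delta>"
    unfolding warp_admissible_def
  proof (intro conjI allI ballI)
    show "Metric_space UNIV \<delta>"
    proof
      fix z w y :: 'a
      have lower: "\<bar>v a - v b\<bar> / 2 \<le> \<delta> a b" "dist a b / 2 \<le> \<delta> a b" for a b
        by (simp_all add: \<delta>_def)
      have "\<bar>v z - v y\<bar> / 2 \<le> \<delta> z w + \<delta> w y"
        using lower(1)[of z w] lower(1)[of w y] abs_triangle_ineq[of "v z - v w" "v w - v y"]
        by (simp add: field_simps)
      moreover have "dist z y / 2 \<le> \<delta> z w + \<delta> w y"
        using lower(2)[of z w] lower(2)[of w y] dist_triangle[of z y w] by linarith
      ultimately show "\<delta> z y \<le> \<delta> z w + \<delta> w y"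
        by (subst \<delta>_def) (rule max.boundedI)
      show "\<delta> z w = 0 \<longleftrightarrow> z = w"
      proof
        assume "\<delta> z w = 0"
        then have "dist z w / 2 \<le> 0" unfolding \<delta>_def by (metis max.cobounded2)
        then show "z = w" by simp
      qed (simp add: \<delta>_def)
    qed (auto simp: \<delta>_def dist_commute abs_minus_commute le_max_iff_disj)
    fix z w
    show "\<delta> z w \<le> real N * dist z w"
      using vl[of z w] half N(1) by (auto simp: \<delta>_def warp_admissible_def)
  next
    fix z g assume g: "g \<in> carrier G"
    have "\<bar>v z - v (act g z)\<bar> / 2 \<le> real (len g)"
    proof (cases "len g = 0")
      case True
      then have "g = \<one>\<^bsub>G\<^esub>" using len g by (auto simp: proper_length_function_def)
      then show ?thesis by (simp add: action_identity[OF act])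
    next
      case False
      then have "1 \<le> real (len g)" by simp
      moreover have "\<bar>v z - v (act g z)\<bar> \<le> real (len g) + 1"
        using v[of z] v[of "act g z"] ug[OF g, of z] by linarith
      ultimately show ?thesis by (simp add: field_simps)
    qed
    then show "\<delta> z (act g z) \<le> real (len g)"
      using half g by (simp add: \<delta>_def warp_admissible_def)
  qed
  then have "\<delta> x y \<le> warped_dist G len act (real N) x y"
    using warped_dist_greatest(2)[OF act len bdd diam N(1)] by (simp add: le_fun_def)
  moreover have "S < \<delta> x y"
    using v[of x] v[of y] ux uy n unfolding \<delta>_def by (simp add: less_max_iff_disj) linarith
  ultimately show ?thesis by (intro exI[of _ N]) (auto simp: N_def)
qed

section \<open>Warped cones over expanding actions\<close>

text \<open>A coarse embedding need not be measurable. Precomposing it with a map of finite range that moves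
  points by less than \<open>e\<close> makes it measurable, and at scale \<open>e = 1 / t\<close> changes it only by a bounded
  amount in the warped metric.\<close>

lemma finite_borel_discretization:
  assumes comp: "compact (UNIV::'a::metric_space set)" and e: "0 < e"
  shows "\<exists>r::'a \<Rightarrow> 'a. finite (range r) \<and> r \<in> borel \<rightarrow>\<^sub>M count_space UNIV \<and> (\<forall>x. dist x (r x) < e)"
proof -
  have gen: "\<exists>r::'a \<Rightarrow> 'a. finite (range r) \<and> r \<in> borel \<rightarrow>\<^sub>M count_space UNIV \<and>
      (\<forall>x\<in>(\<Union>c\<in>C. ball c e). dist x (r x) < e)" if "finite C" for C
    using that
  proof induction
    case empty
    show ?case by (rule exI[of _ "\<lambda>_. undefined"]) auto
  next
    case (insert c C)
    then obtain r :: "'a \<Rightarrow> 'a" where r: "finite (range r)" "r \<in> borel \<rightarrow>\<^sub>M count_space UNIV"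
      "\<forall>x\<in>(\<Union>c\<in>C. ball c e). dist x (r x) < e" by blast
    define r' where "r' = (\<lambda>x. if x \<in> ball c e then c else r x)"
    have "range r' \<subseteq> insert c (range r)" by (auto simp: r'_def)
    then have "finite (range r')" using r(1) by (meson finite_insert finite_subset)
    moreover have "r' \<in> borel \<rightarrow>\<^sub>M count_space UNIV"
      unfolding r'_def using r(2) by (intro measurable_If_set) auto
    moreover have "dist x (r' x) < e" if "x \<in> (\<Union>c\<in>insert c C. ball c e)" for x
      using that r(3) by (auto simp: r'_def dist_commute)
    ultimately show ?case by blast
  qed
  have cover: "(UNIV::'a set) \<subseteq> (\<Union>c\<in>UNIV. ball c e)"
  proof
    fix x :: 'a show "x \<in> (\<Union>c\<in>UNIV. ball c e)" using e by (intro UN_I[of x]) auto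
  qed
  obtain C where C: "finite C" "(UNIV::'a set) \<subseteq> (\<Union>c\<in>C. ball c e)"
    using compactE_image[OF comp _ cover] open_ball by metis
  show ?thesis using gen[OF C(1)] C(2) by blast
qed

theorem propositionH:
  fixes \<nu> :: "'a::metric_space measure"
    and G :: "('g, 'm) monoid_scheme"
    and len :: "'g \<Rightarrow> nat"
    and act :: "'g \<Rightarrow> 'a \<Rightarrow> 'a"
  assumes "compact (UNIV :: 'a set)"
    and "diameter (UNIV :: 'a set) \<le> 2"
    and "prob_space \<nu>"
    and "sets \<nu> = sets borel"
    and "\<forall>x. emeasure \<nu> {x} = 0"
    and "countable (carrier G)"
    and "proper_length_function G len"
    and "group_action G UNIV act"
    and "\<forall>g\<in>carrier G. continuous_on UNIV (act g)"
    and "measure_class_preserving G act \<nu>"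
    and "asymptotically_expanding G len act \<nu>"
  shows "\<not> (\<exists>F :: 'a \<times> real \<Rightarrow> 'h::{real_inner, complete_space}.
    coarse_embedding warped_cone (warped_cone_dist G len act) UNIV dist F)"
proof
  note comp = assms(1) and diam = assms(2) and borel = assms(4) and len = assms(7) and act = assms(8)
    and cont = assms(9)
  note bdd = compact_imp_bounded[OF comp]
  interpret prob_space \<nu> by fact
  have sp: "space \<nu> = UNIV" using sets_eq_imp_space_eq[OF borel] by simp
  assume "\<exists>F :: 'a \<times> real \<Rightarrow> 'h. coarse_embedding warped_cone (warped_cone_dist G len act) UNIV dist F"
  then obtain F :: "'a \<times> real \<Rightarrow> 'h" and rm rp where rm: "control_function rm" and rp: "control_function rp"
    and F: "\<And>p q. p \<in> warped_cone \<Longrightarrow> q \<in> warped_cone \<Longrightarrow> rm (warped_cone_dist G len act p q) \<le> dist (F p) (F q)"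
      "\<And>p q. p \<in> warped_cone \<Longrightarrow> q \<in> warped_cone \<Longrightarrow> dist (F p) (F q) \<le> rp (warped_cone_dist G len act p q)"
    unfolding coarse_embedding_def by blast
  define d where "d = warped_dist G len act"
  note d = warped_dist_le[OF act len bdd diam, folded d_def]
  note d_mono = warped_dist_mono[OF act len bdd diam, folded d_def]
  have F1: "rm (d t x y) \<le> dist (F (x, t)) (F (y, t))" and F2: "dist (F (x, t)) (F (y, t)) \<le> rp (d t x y)"
    if "1 \<le> t" for x y t
    using F[of "(x, t)" "(y, t)"] that by (auto simp: warped_cone_def warped_cone_dist_def d_def)
  obtain k where k: "\<And>L. \<exists>R. \<forall>f :: 'a \<Rightarrow> 'h.
    finite (range f) \<longrightarrow> f \<in> \<nu> \<rightarrow>\<^sub>M count_space UNIV \<longrightarrow>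
    (\<forall>g\<in>length_ball G len k. \<forall>x. dist (f (act g x)) (f x) \<le> L) \<longrightarrow>
    (\<exists>Y\<in>sets \<nu>. 1/2 \<le> measure \<nu> Y \<and> (\<forall>x\<in>Y. \<forall>y\<in>Y. dist (f x) (f y) \<le> R))"
    using Hilbert_concentration[OF assms(3) borel len act cont assms(11)] by blast
  obtain R where R: "\<And>f :: 'a \<Rightarrow> 'h.
    finite (range f) \<Longrightarrow> f \<in> \<nu> \<rightarrow>\<^sub>M count_space UNIV \<Longrightarrow>
    (\<forall>g\<in>length_ball G len k. \<forall>x. dist (f (act g x)) (f x) \<le> rp (real k + 2)) \<Longrightarrow>
    (\<exists>Y\<in>sets \<nu>. 1/2 \<le> measure \<nu> Y \<and> (\<forall>x\<in>Y. \<forall>y\<in>Y. dist (f x) (f y) \<le> R))"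
    using k[of "rp (real k + 2)"] by blast
  \<comment> \<open>Points at distance at least \<open>S0\<close> in the cone have images more than \<open>R\<close> apart.\<close>
  obtain S0 where S0: "0 \<le> S0" "R < rm S0"
    using rm unfolding control_function_def bdd_above_def by (auto simp: not_le)
  \<comment> \<open>Discretizing the slice moves each of the two points by at most 1.\<close>
  define S where "S = S0 + 2"
  have slice: "\<exists>Y\<in>sets \<nu>. 1/2 \<le> measure \<nu> Y \<and> (\<forall>x\<in>Y. \<forall>y\<in>Y. d t x y \<le> S)" if t: "1 \<le> t" for t
  proof -
    obtain r :: "'a \<Rightarrow> 'a" where r: "finite (range r)" "r \<in> borel \<rightarrow>\<^sub>M count_space UNIV" "\<And>x. dist x (r x) < 1 / t"
      using finite_borel_discretization[OF comp, of "1 / t"] t by auto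
    have dr: "d t x (r x) \<le> 1" "d t (r x) x \<le> 1" for x
    proof -
      have "d t x (r x) \<le> t * dist x (r x)" by (rule d[OF t])
      also have "\<dots> \<le> t * (1 / t)" using r(3)[of x] t by (intro mult_left_mono) auto
      finally show "d t x (r x) \<le> 1" using t by simp
      then show "d t (r x) x \<le> 1" using d(4)[OF t] by metis
    qed
    define f where "f = (\<lambda>x. F (r x, t))"
    have "finite (range f)" using finite_imageI[OF r(1), of "\<lambda>x. F (x, t)"] by (simp add: f_def image_image)
    moreover have "f \<in> \<nu> \<rightarrow>\<^sub>M count_space UNIV"
      unfolding f_def measurable_cong_sets[OF borel refl] by (rule measurable_compose[OF r(2)]) simp
    moreover have "dist (f (act g x)) (f x) \<le> rp (real k + 2)" if g: "g \<in> length_ball G len k" for g x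
    proof -
      have gc: "g \<in> carrier G" "len g \<le> k" using g by (auto simp: length_ball_def)
      have "d t (r (act g x)) (r x) \<le> d t (r (act g x)) (act g x) + d t (act g x) (r x)" by (rule d[OF t])
      also have "d t (act g x) (r x) \<le> d t (act g x) x + d t x (r x)" by (rule d[OF t])
      also have "d t (act g x) x \<le> real (len g)" using d(2)[OF t gc(1), of x] d(4)[OF t] by metis
      finally have "d t (r (act g x)) (r x) \<le> real k + 2"
        using dr(1)[of x] dr(2)[of "act g x"] gc(2) by simp
      then have "rp (d t (r (act g x)) (r x)) \<le> rp (real k + 2)"
        using rp d(3)[OF t] unfolding control_function_def by (auto intro!: mono_onD[of "{0..}" rp])
      then show ?thesis using F2[OF t, of "r (act g x)" "r x"] by (simp add: f_def)
    qed
    ultimately obtain Y where Y: "Y \<in> sets \<nu>" "1/2 \<le> measure \<nu> Y" "\<And>x y. x \<in> Y \<Longrightarrow> y \<in> Y \<Longrightarrow> dist (f x) (f y) \<le> R"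
      using R[of f] by blast
    have "d t x y \<le> S" if "x \<in> Y" "y \<in> Y" for x y
    proof -
      have "d t (r x) (r y) \<le> S0"
      proof (rule ccontr)
        assume "\<not> ?thesis"
        then have "rm S0 \<le> rm (d t (r x) (r y))"
          using rm S0 unfolding control_function_def by (auto intro!: mono_onD[of "{0..}" rm])
        then show False using F1[OF t, of "r x" "r y"] Y(3)[OF that] S0(2) by (simp add: f_def)
      qed
      moreover have "d t x y \<le> d t x (r x) + (d t (r x) (r y) + d t (r y) y)"
        using d(5)[OF t, of x y "r x"] d(5)[OF t, of "r x" y "r y"] by linarith
      ultimately show ?thesis using dr(1)[of x] dr(2)[of y] by (simp add: S_def)
    qed
    then show ?thesis using Y by blast
  qed
  have "\<exists>Y. Y \<in> sets \<nu> \<and> 1/2 \<le> measure \<nu> Y \<and> (\<forall>x\<in>Y. \<forall>y\<in>Y. d (real (Suc n)) x y \<le> S)" for n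
    using slice[of "real (Suc n)"] by auto
  then obtain Y where Y: "\<And>n. Y n \<in> sets \<nu>" "\<And>n. 1/2 \<le> measure \<nu> (Y n)"
    "\<And>n x y. x \<in> Y n \<Longrightarrow> y \<in> Y n \<Longrightarrow> d (real (Suc n)) x y \<le> S" by metis
  have "Y n \<noteq> {}" for n using Y(2)[of n] by auto
  then have "\<forall>n. \<exists>q. q \<in> Y n" by blast
  then obtain p where p: "\<And>n. p n \<in> Y n" using choice[of "\<lambda>n q. q \<in> Y n"] by blast
  obtain x \<rho> where \<rho>: "strict_mono (\<rho> :: nat \<Rightarrow> nat)" and lim: "(p \<circ> \<rho>) \<longlonglongrightarrow> x"
    using comp unfolding compact_def by (metis UNIV_I)
  \<comment> \<open>Fixing the parameter \<open>Suc n\<close> of the metric while the index of \<open>Y\<close> grows allows the base points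
    to be replaced by their limit, at the price of 1.\<close>
  define E where "E = (\<lambda>n. {y. d (real (Suc n)) x y \<le> S + 1})"
  have E_sets: "E n \<in> sets \<nu>" for n
  proof -
    have s: "1 \<le> real (Suc n)" by simp
    have "continuous_on UNIV (d (real (Suc n)) x)"
    proof (rule continuous_onI)
      fix y e assume e: "(0::real) < e"
      have "dist (d (real (Suc n)) x z) (d (real (Suc n)) x y) \<le> e" if "dist z y < e / real (Suc n)" for z
      proof -
        have "d (real (Suc n)) y z \<le> real (Suc n) * dist z y" 
          using d(1)[OF s, of y z] by (simp add: dist_commute)
        also have "\<dots> \<le> e" using that by (simp add: field_simps)
        finally have "d (real (Suc n)) y z \<le> e" .
        moreover have "d (real (Suc n)) z y = d (real (Suc n)) y z" by (rule d(4)[OF s])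
        ultimately show ?thesis
          using d(5)[OF s, of x z y] d(5)[OF s, of x y z] by (simp add: dist_real_def abs_le_iff)
      qed
      then show "\<exists>\<delta>>0. \<forall>z\<in>UNIV. dist z y < \<delta> \<longrightarrow> dist (d (real (Suc n)) x z) (d (real (Suc n)) x y) \<le> e"
        using e by (intro exI[of _ "e / real (Suc n)"]) auto
    qed
    then have "closed (E n)" unfolding E_def by (intro closed_Collect_le continuous_on_const)
    then show ?thesis by (simp add: borel)
  qed
  have E_big: "1/2 \<le> measure \<nu> (E n)" for n
  proof -
    have s: "1 \<le> real (Suc n)" by simp
    have "eventually (\<lambda>j. dist (p (\<rho> j)) x < 1 / real (Suc n)) sequentially"
      using tendstoD[OF lim, of "1 / real (Suc n)"] by (simp add: o_def)
    then have "eventually (\<lambda>j. dist (p (\<rho> j)) x < 1 / real (Suc n) \<and> n \<le> j) sequentially"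
      using eventually_ge_at_top by (rule eventually_conj)
    then obtain j where j: "dist (p (\<rho> j)) x < 1 / real (Suc n)" "n \<le> j"
      by (auto dest: eventually_happens)
    have nj: "real (Suc n) \<le> real (Suc (\<rho> j))" using seq_suble[OF \<rho>, of j] j(2) by simp
    have "Y (\<rho> j) \<subseteq> E n"
    proof
      fix y assume y: "y \<in> Y (\<rho> j)"
      have "d (real (Suc n)) x y \<le> d (real (Suc n)) x (p (\<rho> j)) + d (real (Suc n)) (p (\<rho> j)) y"
        by (rule d(5)[OF s])
      also have "d (real (Suc n)) x (p (\<rho> j)) \<le> real (Suc n) * dist x (p (\<rho> j))" by (rule d(1)[OF s])
      also have "\<dots> \<le> 1" using j(1) by (simp add: field_simps dist_commute)
      also have "d (real (Suc n)) (p (\<rho> j)) y \<le> d (real (Suc (\<rho> j))) (p (\<rho> j)) y"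
        by (rule d_mono[OF s nj])
      also have "\<dots> \<le> S" by (rule Y(3)[OF p y])
      finally show "y \<in> E n" by (simp add: E_def)
    qed
    then have "measure \<nu> (Y (\<rho> j)) \<le> measure \<nu> (E n)" by (intro finite_measure_mono E_sets)
    then show ?thesis using Y(2)[of "\<rho> j"] by simp
  qed
  have "decseq E"
  proof (rule decseq_SucI, rule subsetI)
    fix n y assume "y \<in> E (Suc n)"
    moreover have "d (real (Suc n)) x y \<le> d (real (Suc (Suc n))) x y" by (rule d_mono) auto
    ultimately show "y \<in> E n" by (simp add: E_def)
  qed
  then have "(\<lambda>n. measure \<nu> (E n)) \<longlonglongrightarrow> measure \<nu> (\<Inter>n. E n)"
    using E_sets by (intro finite_Lim_measure_decseq) auto
  then have pos: "1/2 \<le> measure \<nu> (\<Inter>n. E n)"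
    by (rule LIMSEQ_le_const) (use E_big in auto)
  define Orb where "Orb = (\<lambda>g. act (inv\<^bsub>G\<^esub> g) x) ` carrier G"
  have "(\<Inter>n. E n) \<subseteq> Orb"
  proof
    fix y assume y: "y \<in> (\<Inter>n. E n)"
    show "y \<in> Orb"
    proof (rule ccontr)
      assume "y \<notin> Orb"
      then have "act g y \<noteq> x" if "g \<in> carrier G" for g
        using action_inverse(1)[OF act that, of y] that \<open>y \<notin> Orb\<close> unfolding Orb_def by (metis imageI)
      then obtain N :: nat where N: "1 \<le> N" "S + 1 < d (real N) x y"
        using warped_dist_unbounded[OF comp diam act len cont, of y x "S + 1"] by (auto simp: d_def)
      then have "y \<notin> E (N - 1)" by (simp add: E_def)
      then show False using y by blast
    qed
  qed
  moreover have "Orb \<in> null_sets \<nu>"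
  proof -
    have "countable Orb" unfolding Orb_def using assms(6) by simp
    moreover have "{y} \<in> null_sets \<nu>" for y using assms(5) borel by auto
    ultimately have "(\<Union>y\<in>Orb. {y}) \<in> null_sets \<nu>" by (intro null_sets_UN') auto
    then show ?thesis by simp
  qed
  ultimately have "measure \<nu> (\<Inter>n. E n) \<le> 0"
    using finite_measure_mono[of "\<Inter>n. E n" Orb] by (simp add: null_sets_def measure_def)
  then show False using pos by simp
qed

end
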